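(* Let $a,b$ be positive integers and let $\mathbb{T}_{a,b}$ be the infinite $(a,b)$--biregular tree. Let $p_0=\min\left(\frac{2a}{a+b},\frac{2b}{a+b}\right)$. Then: (a) for $t\geq 0$, $$p(\mathbb{T}_{a,b},t)=\frac{2abt+\frac{2ab}{a+b}-\frac{2ab}{a+b}\sqrt{1+(2a+2b-4)t+(a-b)^2t^2}}{2abt+2};$$ (b) for $0\leq p<p_0$, $$t(\mathbb{T}_{a,b},p)=\frac{a+b}{2ab}\cdot\frac{p\left(1-\frac{a+b}{2ab}p\right)}{\left(1-\frac{a+b}{2a}p\right)\left(1-\frac{a+b}{2b}p\right)};$$ (c) for $0\leq p\leq p_0$, $$\lambda_{\mathbb{T}_{a,b}}(p)=\frac{a}{a+b}H\left(\frac{a+b}{2a}p\right)+\frac{b}{a+b}H\left(\frac{a+b}{2b}p\right)+\frac12p\ln(ab)-\frac{ab}{a+b}H\left(\frac{a+b}{2ab}p\right).$$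
   Context: $H(q)=-(q\ln q+(1-q)\ln(1-q))$, $H(0)=H(1)=0$. For a finite graph $G$ with $m_k(G)$ matchings of size $k$ ($m_0=1$), let $M(G,t)=\sum_k m_k(G)t^k$, $p(G,t)=\frac{2t\,\frac{d}{dt}M(G,t)}{v(G)M(G,t)}$ for $t\geq 0$. Let $\nu(G)$ be the maximum matching size and $p^*(G)=2\nu(G)/v(G)$; $p(G,\cdot)$ is a strictly increasing bijection $[0,\infty)\to[0,p^*(G))$ with inverse $t(G,p)$. For $0\leq p<p^*(G)$ let $\lambda_G(p)=\frac{\ln M(G,t(G,p))}{v(G)}-\frac12p\ln t(G,p)$ (value $0$ at $p=0$), $\lambda_G(p^* )=\lim_{p\nearrow p^*}\lambda_G(p)$, $\lambda_G(p)=0$ for $p>p^*$. Let $(G_i)$ be any sequence of finite $(a,b)$--biregular bipartite graphs (one class of degree $a$, the other of degree $b$) with girth tending to infinity; then $p^*(G_i)=p_0$, and the limits $p(\mathbb{T}_{a,b},t)=\lim_ip(G_i,t)$ ($t\geq 0$), $t(\mathbb{T}_{a,b},p)=\lim_it(G_i,p)$ and $\lambda_{\mathbb{T}_{a,b}}(p)=\lim_i\lambda_{G_i}(p)$ ($0\leq p<p_0$) exist and are independent of the sequence; they define these functions, together with $\lambda_{\mathbb{T}_{a,b}}(p_0)=\lim_{p\nearrow p_0}\lambda_{\mathbb{T}_{a,b}}(p)$. *)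

theory Defs
  imports "HOL-Analysis.Analysis" "HOL-Library.Extended_Nat"
begin

definition Hent :: "real \<Rightarrow> real" where
  "Hent q = (if q = 0 \<or> q = 1 then 0 else - (q * ln q + (1 - q) * ln (1 - q)))"

type_synonym graph = "nat set \<times> nat set set"

definition verts :: "graph \<Rightarrow> nat set" where "verts G = fst G"
definition edges :: "graph \<Rightarrow> nat set set" where "edges G = snd G"

definition simple_graph :: "graph \<Rightarrow> bool" where
  "simple_graph G \<longleftrightarrow> finite (verts G) \<and>
     (\<forall>e\<in>edges G. \<exists>u v. u \<noteq> v \<and> u \<in> verts G \<and> v \<in> verts G \<and> e = {u, v})"

definition degree :: "graph \<Rightarrow> nat \<Rightarrow> nat" where
  "degree G v = card {e \<in> edges G. v \<in> e}"

definition is_matching :: "graph \<Rightarrow> nat set set \<Rightarrow> bool" where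
  "is_matching G M \<longleftrightarrow> M \<subseteq> edges G \<and> (\<forall>e\<in>M. \<forall>f\<in>M. e \<noteq> f \<longrightarrow> e \<inter> f = {})"

definition match_count :: "graph \<Rightarrow> nat \<Rightarrow> nat" where
  "match_count G k = card {M. is_matching G M \<and> card M = k}"

definition match_poly :: "graph \<Rightarrow> real \<Rightarrow> real" where
  "match_poly G t = (\<Sum>k\<le>card (edges G). real (match_count G k) * t ^ k)"

definition p_fun :: "graph \<Rightarrow> real \<Rightarrow> real" where
  "p_fun G t = 2 * t * deriv (match_poly G) t / (real (card (verts G)) * match_poly G t)"

definition match_num :: "graph \<Rightarrow> nat" where
  "match_num G = Max {card M | M. is_matching G M}"

definition pstar :: "graph \<Rightarrow> real" where
  "pstar G = 2 * real (match_num G) / real (card (verts G))"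

text \<open>inverse of p(G,.) on [0, p*(G))\<close>
definition t_fun :: "graph \<Rightarrow> real \<Rightarrow> real" where
  "t_fun G p = (THE t. t \<ge> 0 \<and> p_fun G t = p)"

definition lambda_open :: "graph \<Rightarrow> real \<Rightarrow> real" where
  "lambda_open G p = (if p = 0 then 0 else
      ln (match_poly G (t_fun G p)) / real (card (verts G)) - p / 2 * ln (t_fun G p))"

definition lambda_G :: "graph \<Rightarrow> real \<Rightarrow> real" where
  "lambda_G G p = (if 0 \<le> p \<and> p < pstar G then lambda_open G p
     else if p = pstar G then Lim (at_left (pstar G)) (lambda_open G)
     else 0)"

text \<open>cycles (as lists of distinct vertices, length at least 3) and girth
  (infinite for forests)\<close>
definition is_cycle :: "graph \<Rightarrow> nat list \<Rightarrow> bool" where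
  "is_cycle G xs \<longleftrightarrow> length xs \<ge> 3 \<and> distinct xs \<and>
     (\<forall>i < length xs. {xs ! i, xs ! ((i + 1) mod length xs)} \<in> edges G)"

definition girth :: "graph \<Rightarrow> enat" where
  "girth G = Inf {enat (length xs) | xs. is_cycle G xs}"

definition biregular_bipartite :: "nat \<Rightarrow> nat \<Rightarrow> graph \<Rightarrow> bool" where
  "biregular_bipartite a b G \<longleftrightarrow> simple_graph G \<and>
     (\<exists>A B. A \<inter> B = {} \<and> A \<union> B = verts G \<and>
        (\<forall>e\<in>edges G. \<exists>x\<in>A. \<exists>y\<in>B. e = {x, y}) \<and>
        (\<forall>x\<in>A. degree G x = a) \<and> (\<forall>y\<in>B. degree G y = b))"

end

(*
  Write r(G,v) = M(G-v,t)/M(G,t). Then r(G,v) = 1/(1 + t * sum of r(G-v,u) over the neighbours u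
  of v), and p(G,t) is the average of 1 - r(G,v). Unfolding the recursion along paths, every
  vertex other than the starting one has lost exactly one neighbour as long as no short cycle is
  met. So up to a depth governed by the girth, r is squeezed between the iterates of the
  recursion of the infinite tree, whose second iterate is a contraction. Everything becomes
  rational in the coordinate q = (a+b)p/(2ab): the activity is
  t = q(1-q)/((1-aq)(1-bq)) and the fixed points of the tree recursion are
  (1-aq)/(1-q) and (1-bq)/(1-q). Since p is increasing in t, the inverse functions t(G_i,p)
  converge. As p/(2t) is the t-derivative of ln M / v(G) and is at most (a+b)/2,
  dominated convergence gives the limit of ln M / v(G), hence that of lambda.
*)
theory Submission
  imports Defs
begin

section \<open>Matching generating functions\<close>

text \<open>In the limit, q is the probability that a given edge lies in a random matching
  \<open>M\<close> of weight \<open>t ^ card M\<close>: there are ab/(a+b) edges and p/2 matching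
  edges per vertex. So 1 - aq and 1 - bq are the probabilities that a vertex of degree a or b stays
  uncovered, and dividing by 1 - q conditions on one given edge being absent. This produces the
  fixed points x and y; comparing the two states of an edge gives q/(1 - q) = txy, which is the
  formula for the activity. The value p*(G_i) is never computed. That p < p0 is attained by p(G_i,
  .) for large i follows because the limit density at a slightly larger activity exceeds p.
  Integration is carried out in q, where the limit has an elementary antiderivative. At p0 the
  activity is infinite and the two terms of lambda diverge separately; only their regrouping into
  entropies extends continuously to p0.\<close>

definition matchings :: "'a set set \<Rightarrow> 'a set set set" where
  "matchings E = {M. M \<subseteq> E \<and> pairwise disjnt M}"

definition mgf :: "'a set set \<Rightarrow> real \<Rightarrow> real" where
  "mgf E t = (\<Sum>M\<in>matchings E. t ^ card M)"

definition remove_vertices :: "'a set set \<Rightarrow> 'a set \<Rightarrow> 'a set set" where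
  "remove_vertices E W = {e \<in> E. e \<inter> W = {}}"

definition nbr :: "'a set set \<Rightarrow> 'a \<Rightarrow> 'a set" where
  "nbr E v = {u. {v, u} \<in> E}"

text \<open>The probability that \<open>v\<close> is uncovered by a random matching of weight
  \<open>t ^ card M\<close>: the matchings counted in the numerator are exactly those of
  \<open>E\<close> that miss \<open>v\<close>.\<close>

definition ratio :: "'a set set \<Rightarrow> real \<Rightarrow> 'a \<Rightarrow> real" where
  "ratio E t v = mgf (remove_vertices E {v}) t / mgf E t"

lemma finite_matchings: "finite E \<Longrightarrow> finite (matchings E)"
  by (rule finite_subset[of _ "Pow E"]) (auto simp: matchings_def)

lemma empty_in_matchings: "{} \<in> matchings E"
  by (simp add: matchings_def)

lemma finite_remove_vertices: "finite E \<Longrightarrow> finite (remove_vertices E W)"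
  by (simp add: remove_vertices_def)

lemma remove_vertices_subset: "remove_vertices E W \<subseteq> E"
  by (auto simp: remove_vertices_def)

lemma remove_vertices_remove_vertices: "remove_vertices (remove_vertices E W) W' = remove_vertices E (W \<union> W')"
  by (auto simp: remove_vertices_def)

lemma mgf_pos:
  assumes "finite E" "t \<ge> 0"
  shows "mgf E t > 0"
proof -
  have "1 \<le> mgf E t"
    unfolding mgf_def
    using member_le_sum[of "{}" "matchings E" "\<lambda>M. t ^ card M"]
      assms finite_matchings empty_in_matchings by (auto simp: zero_le_power)
  then show ?thesis by simp
qed

lemma ratio_pos: "finite E \<Longrightarrow> t \<ge> 0 \<Longrightarrow> ratio E t v > 0"
  by (simp add: ratio_def mgf_pos finite_remove_vertices)

lemma ratio_nonneg: "finite E \<Longrightarrow> t \<ge> 0 \<Longrightarrow> ratio E t v \<ge> 0"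
  by (simp add: ratio_pos less_imp_le)

text \<open>A matching either misses \<open>v\<close> or contains exactly one edge \<open>e\<close>
  at \<open>v\<close>. Removing \<open>e\<close> then costs a factor \<open>t\<close> and leaves an
  arbitrary matching disjoint from \<open>e\<close>.\<close>

lemma mgf_rec:
  assumes "finite E"
  shows "mgf E t = mgf (remove_vertices E {v}) t + t * (\<Sum>e | e \<in> E \<and> v \<in> e. mgf (remove_vertices E e) t)"
proof -
  let ?N = "{e. e \<in> E \<and> v \<in> e}"
  let ?I = "\<lambda>e. insert e ` matchings (remove_vertices E e)"
  have fin: "finite ?N" using assms by simp
  have notin: "e \<notin> M" if "v \<in> e" "M \<in> matchings (remove_vertices E e)" for e M
    using that by (auto simp: matchings_def remove_vertices_def)
  have split: "matchings E = matchings (remove_vertices E {v}) \<union> (\<Union>e\<in>?N. ?I e)" (is "?l = ?r")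
  proof (intro equalityI subsetI)
    fix M assume M: "M \<in> ?l"
    show "M \<in> ?r"
    proof (cases "\<exists>e\<in>M. v \<in> e")
      case False
      then show ?thesis using M by (auto simp: matchings_def remove_vertices_def)
    next
      case True
      then obtain e where e: "e \<in> M" "v \<in> e" by blast
      have "M - {e} \<in> matchings (remove_vertices E e)"
        using M e by (auto simp: matchings_def remove_vertices_def pairwise_def disjnt_def)
      then have "M \<in> ?I e" using e by (metis image_eqI insert_Diff)
      then show ?thesis using e M by (auto simp: matchings_def)
    qed
  next
    fix M assume "M \<in> ?r"
    then show "M \<in> ?l"
      by (auto simp: matchings_def remove_vertices_def pairwise_insert disjnt_iff) blast+
  qed
  have disj1: "matchings (remove_vertices E {v}) \<inter> (\<Union>e\<in>?N. ?I e) = {}"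
    by (auto simp: matchings_def remove_vertices_def)
  have disj2: "?I e \<inter> ?I f = {}" if "e \<in> ?N" "f \<in> ?N" "e \<noteq> f" for e f
    using that by (auto simp: matchings_def remove_vertices_def)
  have one: "(\<Sum>M\<in>?I e. t ^ card M) = t * mgf (remove_vertices E e) t" if "e \<in> ?N" for e
  proof -
    have "inj_on (insert e) (matchings (remove_vertices E e))"
      using notin that by (intro inj_onI) (metis insert_ident mem_Collect_eq)
    then have "(\<Sum>M\<in>?I e. t ^ card M) = (\<Sum>M\<in>matchings (remove_vertices E e). t ^ card (insert e M))"
      by (simp add: sum.reindex)
    also have "\<dots> = (\<Sum>M\<in>matchings (remove_vertices E e). t * t ^ card M)"
    proof (rule sum.cong)
      fix M assume M: "M \<in> matchings (remove_vertices E e)"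
      then have "finite M" using assms finite_subset by (fastforce simp: matchings_def remove_vertices_def)
      then show "t ^ card (insert e M) = t * t ^ card M"
        using notin[OF _ M] that by simp
    qed simp
    finally show ?thesis by (simp add: mgf_def sum_distrib_left)
  qed
  have "mgf E t = mgf (remove_vertices E {v}) t + (\<Sum>M\<in>(\<Union>e\<in>?N. ?I e). t ^ card M)"
    unfolding mgf_def split
    by (rule sum.union_disjoint) (use assms fin disj1 in \<open>auto simp: finite_matchings finite_remove_vertices\<close>)
  also have "(\<Sum>M\<in>(\<Union>e\<in>?N. ?I e). t ^ card M) = (\<Sum>e\<in>?N. \<Sum>M\<in>?I e. t ^ card M)"
    by (rule sum.UNION_disjoint) (use assms fin disj2 in \<open>auto simp: finite_matchings finite_remove_vertices\<close>)
  also have "\<dots> = t * (\<Sum>e\<in>?N. mgf (remove_vertices E e) t)"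
    by (simp add: one sum_distrib_left)
  finally show ?thesis .
qed

lemma edges_at:
  assumes "\<forall>e\<in>E. card e = 2"
  shows "{e. e \<in> E \<and> v \<in> e} = (\<lambda>u. {v, u}) ` nbr E v"
proof -
  have "\<exists>u. e = {v, u}" if "e \<in> E" "v \<in> e" for e
  proof -
    have "card e = 2" using assms that(1) by blast
    then show ?thesis using that(2) by (auto simp: card_2_iff)
  qed
  then show ?thesis by (auto simp: nbr_def)
qed

lemma inj_pair: "inj_on (\<lambda>u. {v, u}) X"
  by (auto simp: inj_on_def doubleton_eq_iff)

lemma card_edges_at:
  assumes "\<forall>e\<in>E. card e = 2"
  shows "card {e. e \<in> E \<and> v \<in> e} = card (nbr E v)"
  by (simp add: edges_at[OF assms] card_image[OF inj_pair])

lemma finite_nbr: "finite E \<Longrightarrow> finite (nbr E v)"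
  unfolding nbr_def by (rule finite_vimageI[OF _ inj_pair[of v UNIV], unfolded vimage_def])

text \<open>Deleting the edge {v, u} with its ends is deleting \<open>u\<close> after
  \<open>v\<close>, so dividing \<open>mgf_rec\<close> by the function of the graph without
  \<open>v\<close> turns every summand into a ratio of that smaller graph.\<close>

lemma ratio_rec:
  assumes "finite E" "\<forall>e\<in>E. card e = 2" "t \<ge> 0"
  shows "ratio E t v = 1 / (1 + t * (\<Sum>u\<in>nbr E v. ratio (remove_vertices E {v}) t u))"
proof -
  have "mgf E t = mgf (remove_vertices E {v}) t + t * (\<Sum>u\<in>nbr E v. mgf (remove_vertices E {v, u}) t)"
    by (subst mgf_rec[OF assms(1), of t v])
      (simp add: edges_at[OF assms(2)] sum.reindex[OF inj_pair])
  also have "(\<Sum>u\<in>nbr E v. mgf (remove_vertices E {v, u}) t)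
      = mgf (remove_vertices E {v}) t * (\<Sum>u\<in>nbr E v. ratio (remove_vertices E {v}) t u)"
    using mgf_pos[OF finite_remove_vertices[OF assms(1)] assms(3), of "{v}"]
    by (simp add: ratio_def remove_vertices_remove_vertices sum_distrib_left insert_commute)
  finally have "mgf E t = mgf (remove_vertices E {v}) t * (1 + t * (\<Sum>u\<in>nbr E v. ratio (remove_vertices E {v}) t u))"
    by (simp add: algebra_simps)
  then show ?thesis
    using mgf_pos[OF finite_remove_vertices[OF assms(1)] assms(3), of "{v}"]
    by (simp add: ratio_def)
qed

lemma ratio_le_1:
  assumes "finite E" "\<forall>e\<in>E. card e = 2" "t \<ge> 0"
  shows "ratio E t v \<le> 1"
proof -
  have "0 \<le> t * (\<Sum>u\<in>nbr E v. ratio (remove_vertices E {v}) t u)"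
    using assms by (intro mult_nonneg_nonneg sum_nonneg ratio_nonneg finite_remove_vertices)
  then show ?thesis unfolding ratio_rec[OF assms] by (simp add: divide_le_eq)
qed

text \<open>The source of the majorant for dominated convergence: covering probabilities are of
  order \<open>t\<close>, uniformly over graphs of bounded degree.\<close>

lemma one_minus_ratio_le:
  assumes "finite E" "\<forall>e\<in>E. card e = 2" "t \<ge> 0"
  shows "1 - ratio E t v \<le> t * card (nbr E v)"
proof -
  define S where "S = (\<Sum>u\<in>nbr E v. ratio (remove_vertices E {v}) t u)"
  have card2: "\<forall>e\<in>remove_vertices E {v}. card e = 2" using assms(2) remove_vertices_subset by blast
  have S0: "0 \<le> S"
    unfolding S_def using assms by (intro sum_nonneg ratio_nonneg finite_remove_vertices)
  have "S \<le> (\<Sum>u\<in>nbr E v. 1)"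
    unfolding S_def by (intro sum_mono ratio_le_1 finite_remove_vertices assms card2)
  then have S1: "t * S \<le> t * card (nbr E v)"
    using assms(3) by (simp add: mult_left_mono)
  have "1 - 1 / (1 + z) \<le> z" if "z \<ge> 0" for z :: real
    using that by (simp add: field_simps)
  from this[of "t * S"] S0 S1 assms(3) show ?thesis
    unfolding ratio_rec[OF assms] S_def[symmetric] by force
qed

lemma mgf_has_derivative:
  "(mgf E has_real_derivative (\<Sum>M\<in>matchings E. real (card M) * t ^ (card M - Suc 0))) (at t)"
  unfolding mgf_def[abs_def]
  by (auto intro!: derivative_eq_intros sum.cong)

lemma match_poly_eq_mgf:
  assumes "finite (edges G)"
  shows "match_poly G t = mgf (edges G) t"
proof -
  have m: "is_matching G M \<longleftrightarrow> M \<in> matchings (edges G)" for M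
    by (auto simp: is_matching_def matchings_def pairwise_def disjnt_def)
  have "mgf (edges G) t = (\<Sum>k\<le>card (edges G). \<Sum>M\<in>{M \<in> matchings (edges G). card M = k}. t ^ card M)"
    unfolding mgf_def
    by (rule sum.group[symmetric])
      (use assms in \<open>auto simp: finite_matchings card_mono matchings_def\<close>)
  also have "\<dots> = match_poly G t"
    unfolding match_poly_def match_count_def m by (intro sum.cong) auto
  finally show ?thesis by simp
qed

text \<open>Double counting of pairs of a matching \<open>M\<close> and a vertex outside its union,
  since \<open>M\<close> covers 2 * card M vertices. The truncated exponent
  \<open>card M - Suc 0\<close> is harmless at the empty matching, whose coefficient is 0.\<close>

lemma sum_mgf_remove_vertices:
  fixes t :: real
  assumes "finite V" "finite E" "\<forall>e\<in>E. card e = 2 \<and> e \<subseteq> V"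
  shows "(\<Sum>v\<in>V. mgf (remove_vertices E {v}) t)
    = card V * mgf E t - 2 * t * (\<Sum>M\<in>matchings E. real (card M) * t ^ (card M - Suc 0))"
proof -
  have eq: "matchings (remove_vertices E {v}) = {M \<in> matchings E. v \<notin> \<Union>M}" for v
    by (auto simp: matchings_def remove_vertices_def)
  have "(\<Sum>v\<in>V. mgf (remove_vertices E {v}) t) = (\<Sum>M\<in>matchings E. \<Sum>v\<in>{v\<in>V. v \<notin> \<Union>M}. t ^ card M)"
    unfolding mgf_def eq
    by (rule sum.swap_restrict) (use assms finite_matchings in auto)
  also have "\<dots> = (\<Sum>M\<in>matchings E. card V * t ^ card M - 2 * t * (card M * t ^ (card M - Suc 0)))"
  proof (rule sum.cong)
    fix M assume M: "M \<in> matchings E"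
    then have fin: "finite M" using assms(2) finite_subset by (auto simp: matchings_def)
    have sub: "\<Union>M \<subseteq> V" using M assms by (auto simp: matchings_def)
    have "card (\<Union>M) = (\<Sum>e\<in>M. card e)"
      using M assms by (intro card_Union_disjoint) (auto simp: matchings_def intro: finite_subset)
    also have "\<dots> = 2 * card M" using M assms by (simp add: matchings_def subset_iff)
    finally have "card {v\<in>V. v \<notin> \<Union>M} = card V - 2 * card M"
      using card_Diff_subset[OF finite_subset[OF sub assms(1)] sub]
      by (simp add: set_diff_eq)
    moreover have "2 * card M \<le> card V"
      using \<open>card (\<Union>M) = _\<close> \<open>_ = 2 * card M\<close> card_mono[OF assms(1) sub] by simp
    ultimately show "(\<Sum>v\<in>{v\<in>V. v \<notin> \<Union>M}. t ^ card M)
        = card V * t ^ card M - 2 * t * (card M * t ^ (card M - Suc 0))"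
      by (cases "card M") (auto simp: algebra_simps of_nat_diff)
  qed simp
  finally show ?thesis
    by (simp add: sum_subtractf mgf_def sum_distrib_left algebra_simps)
qed

section \<open>The vertex recursion in graphs without short cycles\<close>

text \<open>Symmetric under exchanging \<open>A\<close>, \<open>a\<close> with \<open>B\<close>,
  \<open>b\<close>, so that facts about a vertex need a proof only for \<open>A\<close>. Induction
  along a path also swaps the classes at every step.\<close>

definition biregular :: "'a set set \<Rightarrow> 'a set \<Rightarrow> 'a set \<Rightarrow> nat \<Rightarrow> nat \<Rightarrow> bool" where
  "biregular E A B a b \<longleftrightarrow> finite E \<and> A \<inter> B = {} \<and> (\<forall>e\<in>E. \<exists>x\<in>A. \<exists>y\<in>B. e = {x, y}) \<and>
     (\<forall>x\<in>A. card (nbr E x) = a) \<and> (\<forall>y\<in>B. card (nbr E y) = b)"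

lemma biregular_sym:
  assumes "biregular E A B a b"
  shows "biregular E B A b a"
proof -
  have "\<exists>x\<in>B. \<exists>y\<in>A. e = {x, y}" if "e \<in> E" for e
  proof -
    from that obtain x y where "x \<in> A" "y \<in> B" "e = {x, y}"
      using assms unfolding biregular_def by blast
    moreover have "{x, y} = {y, x}" by (rule insert_commute)
    ultimately show ?thesis by blast
  qed
  then show ?thesis using assms unfolding biregular_def by blast
qed

lemma biregular_finite: "biregular E A B a b \<Longrightarrow> finite E"
  by (simp add: biregular_def)

lemma biregular_card2:
  assumes "biregular E A B a b"
  shows "\<forall>e\<in>E. card e = 2"
proof
  fix e assume "e \<in> E"
  then obtain x y where "x \<in> A" "y \<in> B" "e = {x, y}" using assms unfolding biregular_def by blast
  moreover have "x \<noteq> y" using assms calculation unfolding biregular_def by blast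
  ultimately show "card e = 2" by simp
qed

lemma biregular_nbr:
  assumes "biregular E A B a b" "v \<in> A" "u \<in> nbr E v"
  shows "u \<in> B"
proof -
  obtain x y where "x \<in> A" "y \<in> B" "{v, u} = {x, y}"
    using assms unfolding biregular_def nbr_def by blast
  then show ?thesis using assms unfolding biregular_def by (auto simp: doubleton_eq_iff)
qed

lemma biregular_nbr_neq:
  assumes "biregular E A B a b" "u \<in> nbr E v"
  shows "u \<noteq> v"
proof -
  have "card {v, u} = 2" using biregular_card2[OF assms(1)] assms(2) by (simp add: nbr_def)
  then show ?thesis by auto
qed

lemma nbr_remove_vertices: "v \<notin> W \<Longrightarrow> nbr (remove_vertices E W) v = nbr E v - W"
  by (auto simp: nbr_def remove_vertices_def)

text \<open>The list runs from the current vertex \<open>v\<close> back to the root. An edge from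
  \<open>v\<close> to a path vertex other than its predecessor \<open>hd ws\<close> would close a
  cycle no longer than the path.\<close>

lemma nbr_inter_path:
  assumes dist: "distinct (v # ws)" and succ: "successively (\<lambda>x y. {x, y} \<in> edges G) (v # ws)"
    and ne: "ws \<noteq> []" and cyc: "\<And>xs. is_cycle G xs \<Longrightarrow> length xs > length (v # ws)"
  shows "nbr (edges G) v \<inter> set ws = {hd ws}"
proof -
  have step: "{(v # ws) ! i, (v # ws) ! Suc i} \<in> edges G" if "Suc i < length (v # ws)" for i
    using succ that by (metis successively_conv_nth)
  have "u = hd ws" if u: "u \<in> nbr (edges G) v" "u \<in> set ws" for u
  proof (rule ccontr)
    assume neq: "u \<noteq> hd ws"
    obtain j where j: "j < length ws" "ws ! j = u" using u(2) by (metis in_set_conv_nth)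
    have "j \<noteq> 0" using neq j ne by (metis hd_conv_nth)
    \<comment> \<open>The stretch from \<open>v\<close> to \<open>u\<close>. Since \<open>j\<close>
      is not 0, it has at least 3 vertices.\<close>
    define xs where "xs = take (Suc (Suc j)) (v # ws)"
    have len: "length xs = Suc (Suc j)" using j by (simp add: xs_def)
    have nth: "xs ! i = (v # ws) ! i" if "i \<le> Suc j" for i
      using that unfolding xs_def by (intro nth_take) simp
    have "{xs ! i, xs ! ((i + 1) mod length xs)} \<in> edges G" if "i < length xs" for i
    \<comment> \<open>The last index wraps around to 0 and stands for the closing edge from
      \<open>u\<close> to \<open>v\<close>.\<close>
    proof (cases "i = Suc j")
      case True
      then have "xs ! i = u" "xs ! ((i + 1) mod length xs) = v"
        using j nth len by simp_all
      then show ?thesis using u(1) by (simp add: nbr_def insert_commute)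
    next
      case False
      then show ?thesis using step[of i] that j len nth by simp
    qed
    moreover have "distinct xs" using dist unfolding xs_def by (metis distinct_take)
    ultimately have "is_cycle G xs" using \<open>j \<noteq> 0\<close> len by (auto simp: is_cycle_def)
    from cyc[OF this] show False using len j by simp
  qed
  moreover have "hd ws \<in> nbr (edges G) v"
    using step[of 0] ne by (simp add: nbr_def hd_conv_nth)
  moreover have "hd ws \<in> set ws" using ne by simp
  ultimately show ?thesis by blast
qed

text \<open>Here c is the number of children of the root and d that of its children; the two
  alternate from level to level. Even depths bound the ratio from below, odd depths from above.\<close>

fun tree_ratio :: "real \<Rightarrow> nat \<Rightarrow> real \<Rightarrow> real \<Rightarrow> real" where
  "tree_ratio t 0 c d = 0"
| "tree_ratio t (Suc n) c d = 1 / (1 + t * (c * tree_ratio t n d c))"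

lemma tree_ratio_nonneg: "t \<ge> 0 \<Longrightarrow> c \<ge> 0 \<Longrightarrow> d \<ge> 0 \<Longrightarrow> tree_ratio t n c d \<ge> 0"
  by (induction n arbitrary: c d) auto

lemma inverse_one_plus_antimono:
  fixes t :: real
  assumes "t \<ge> 0" "0 \<le> y" "y \<le> z"
  shows "1 / (1 + t * z) \<le> 1 / (1 + t * y)"
  using assms by (intro frac_le) (auto intro: mult_left_mono add_pos_nonneg)

text \<open>The vertices \<open>ws\<close> are already deleted, and \<open>v\<close> has lost only
  its parent \<open>hd ws\<close>, so it keeps \<open>a - 1\<close> neighbours as in the tree. Each
  step of the recursion reverses inequalities, whence the parity. The bound on
  \<open>length (v # ws) + n\<close> keeps every cycle out of reach of the remaining levels.\<close>

lemma ratio_path_bounds: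
  assumes "biregular (edges G) A B a b" "v \<in> A" "t \<ge> 0"
    and "distinct (v # ws)" "successively (\<lambda>x y. {x, y} \<in> edges G) (v # ws)" "ws \<noteq> []"
    and "\<And>xs. is_cycle G xs \<Longrightarrow> length xs > K" "length (v # ws) + n \<le> K"
  shows "if even n then tree_ratio t n (real a - 1) (real b - 1) \<le> ratio (remove_vertices (edges G) (set ws)) t v
    else ratio (remove_vertices (edges G) (set ws)) t v \<le> tree_ratio t n (real a - 1) (real b - 1)"
  using assms
proof (induction n arbitrary: A B a b v ws)
  case 0
  then show ?case by (simp add: ratio_nonneg finite_remove_vertices biregular_finite)
next
  case (Suc n)
  let ?E = "edges G" and ?D = "remove_vertices (edges G) (set ws)"
  note reg = Suc.prems(1)
  have fin: "finite ?E" using reg by (rule biregular_finite)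
  have card2: "\<forall>e\<in>?D. card e = 2" using biregular_card2[OF reg] remove_vertices_subset by blast
  have nbrD: "nbr ?D v = nbr ?E v - set ws" using Suc.prems(4) by (intro nbr_remove_vertices) auto
  have int: "nbr ?E v \<inter> set ws = {hd ws}"
  proof (rule nbr_inter_path[OF Suc.prems(4-6)])
    fix xs assume "is_cycle G xs"
    from Suc.prems(7)[OF this] Suc.prems(8) show "length xs > length (v # ws)" by simp
  qed
  have degv: "card (nbr ?E v) = a" using reg Suc.prems(2) by (simp add: biregular_def)
  have "card (nbr ?D v) = a - 1"
    unfolding nbrD using card_Diff_subset_Int[of "nbr ?E v" "set ws"] int degv by simp
  \<comment> \<open>The parent is a neighbour of \<open>v\<close>; this makes the natural number
    \<open>a - 1\<close> agree with \<open>real a - 1\<close>.\<close>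
  moreover have "a \<ge> 1"
    using int degv card_gt_0_iff[of "nbr ?E v"] finite_nbr[OF fin, of v] by auto
  ultimately have card: "real (card (nbr ?D v)) = real a - 1" by simp
  let ?r = "ratio (remove_vertices ?E (set (v # ws))) t"
  define J where "J = tree_ratio t n (real b - 1) (real a - 1)"
  have child: "if even n then J \<le> ?r u else ?r u \<le> J" if u: "u \<in> nbr ?D v" for u
    unfolding J_def
  proof (rule Suc.IH)
    show "biregular ?E B A b a" using reg by (rule biregular_sym)
    show "u \<in> B" using u biregular_nbr[OF reg Suc.prems(2)] nbrD by blast
    have "u \<noteq> v" using u biregular_nbr_neq[OF reg] nbrD by blast
    then show "distinct (u # v # ws)" using Suc.prems(4) u nbrD by auto
    show "successively (\<lambda>x y. {x, y} \<in> ?E) (u # v # ws)"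
      using u Suc.prems(5) by (simp add: nbr_def remove_vertices_def insert_commute)
  qed (use Suc.prems in auto)
  define S where "S = (\<Sum>u\<in>nbr ?D v. ?r u)"
  have rec: "ratio ?D t v = 1 / (1 + t * S)"
    by (subst ratio_rec) (use fin card2 Suc.prems(3) in \<open>auto simp: finite_remove_vertices remove_vertices_remove_vertices S_def\<close>)
  have S0: "S \<ge> 0"
    unfolding S_def by (intro sum_nonneg ratio_nonneg finite_remove_vertices fin Suc.prems(3))
  \<comment> \<open>Nonnegativity of \<open>J\<close> requires b to be at least 1. A child has
    \<open>v\<close> as a neighbour, which gives this; without children the factor
    \<open>real a - 1\<close> vanishes.\<close>
  have J0: "(real a - 1) * J \<ge> 0"
  proof (cases "a = 1")
    case False
    then have "nbr ?D v \<noteq> {}" using card by auto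
    then obtain u where "u \<in> nbr ?D v" by blast
    then have "u \<in> nbr ?E v" by (simp add: nbrD)
    then have "u \<in> B" "v \<in> nbr ?E u" using biregular_nbr[OF reg Suc.prems(2)] by (auto simp: nbr_def insert_commute)
    moreover have "card (nbr ?E u) = b" if "u \<in> B" using reg that by (simp add: biregular_def)
    ultimately have "b \<ge> 1" using card_gt_0_iff[of "nbr ?E u"] finite_nbr[OF fin, of u] by auto
    then show ?thesis unfolding J_def using \<open>a \<ge> 1\<close> Suc.prems(3)
      by (intro mult_nonneg_nonneg tree_ratio_nonneg) auto
  qed simp
  show ?case
  proof (cases "even n")
    case True
    then have "(\<Sum>u\<in>nbr ?D v. J) \<le> S" unfolding S_def using child by (intro sum_mono) auto
    then have "(real a - 1) * J \<le> S" using card by simp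
    then show ?thesis
      using True J0 Suc.prems(3) inverse_one_plus_antimono[of t] unfolding rec by (simp add: J_def)
  next
    case False
    then have "S \<le> (\<Sum>u\<in>nbr ?D v. J)" unfolding S_def using child by (intro sum_mono) auto
    then have "S \<le> (real a - 1) * J" using card by simp
    then show ?thesis
      using False S0 Suc.prems(3) inverse_one_plus_antimono[of t] unfolding rec by (simp add: J_def)
  qed
qed

text \<open>The root has no deleted parent, so all \<open>a\<close> neighbours survive, and each
  starts a branch with deleted path \<open>[v]\<close>. The offset 3 accounts for the two vertices
  of that path and for using depth \<open>Suc n\<close> as well as \<open>n\<close>.\<close>

lemma ratio_root_bounds:
  assumes reg: "biregular (edges G) A B a b" and v: "v \<in> A" and t: "t \<ge> 0" and "a \<ge> 1" "b \<ge> 1"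
    and cyc: "\<And>xs. is_cycle G xs \<Longrightarrow> length xs > K" and n: "even n" "n + 3 \<le> K"
  shows "1 / (1 + t * (a * tree_ratio t (Suc n) (real b - 1) (real a - 1))) \<le> ratio (edges G) t v"
    and "ratio (edges G) t v \<le> 1 / (1 + t * (a * tree_ratio t n (real b - 1) (real a - 1)))"
proof -
  let ?E = "edges G" 
  have fin: "finite ?E" using reg by (rule biregular_finite)
  let ?r = "ratio (remove_vertices ?E {v}) t"
  let ?J = "\<lambda>m. tree_ratio t m (real b - 1) (real a - 1)"
  have child: "if even m then ?J m \<le> ?r u else ?r u \<le> ?J m"
    if u: "u \<in> nbr ?E v" and m: "2 + m \<le> K" for u m
  proof -
    have "u \<noteq> v" using u by (rule biregular_nbr_neq[OF reg])
    then show ?thesis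
      using ratio_path_bounds[OF biregular_sym[OF reg] biregular_nbr[OF reg v u] t _ _ _ cyc, of "[v]" m] u m
      by (simp add: nbr_def insert_commute split: if_splits)
  qed
  define S where "S = (\<Sum>u\<in>nbr ?E v. ?r u)"
  have rec: "ratio ?E t v = 1 / (1 + t * S)"
    unfolding S_def by (rule ratio_rec) (use fin biregular_card2[OF reg] t in auto)
  have S0: "S \<ge> 0"
    unfolding S_def by (intro sum_nonneg ratio_nonneg finite_remove_vertices fin t)
  have J0: "?J m \<ge> 0" for m using assms by (intro tree_ratio_nonneg) auto
  have card: "card (nbr ?E v) = a" using reg v by (simp add: biregular_def)
  have "(\<Sum>u\<in>nbr ?E v. ?J n) \<le> S" "S \<le> (\<Sum>u\<in>nbr ?E v. ?J (Suc n))"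
    unfolding S_def using child[of _ n] child[of _ "Suc n"] n by (auto intro!: sum_mono simp del: sum_constant tree_ratio.simps)
  then have "a * ?J n \<le> S" "S \<le> a * ?J (Suc n)" using card by simp_all
  then show "1 / (1 + t * (a * ?J (Suc n))) \<le> ratio ?E t v"
    "ratio ?E t v \<le> 1 / (1 + t * (a * ?J n))"
    unfolding rec using t S0 J0 by (auto intro!: inverse_one_plus_antimono simp del: tree_ratio.simps)
qed

section \<open>Convergence of the tree recursion\<close>

text \<open>Two steps form the Moebius map w -> (1 + Dw)/(1 + C + Dw), whose values at z and x
  differ by exactly CD(z - x) over the product of the two denominators. The one at z is at least 1 +
  C. The fixed point equation turns the one at x into 1/x + D, which is at least 1 + D because x is
  at most 1.\<close>

lemma tree_ratio_contraction:
  assumes t: "t \<ge> 0" and c: "c \<ge> 0" and d: "d \<ge> 0" and x: "x > 0" and y: "y > 0"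
    and fx: "x = 1 / (1 + t * (c * y))" and fy: "y = 1 / (1 + t * (d * x))"
  shows "\<bar>tree_ratio t (Suc (Suc n)) c d - x\<bar>
    \<le> (t * c) * (t * d) / ((1 + t * c) * (1 + t * d)) * \<bar>tree_ratio t n c d - x\<bar>"
proof -
  define C D z where "C = t * c" and "D = t * d" and "z = tree_ratio t n c d"
  have CD: "C \<ge> 0" "D \<ge> 0" "z \<ge> 0" using t c d by (simp_all add: C_def D_def z_def tree_ratio_nonneg)
  have two: "1 / (1 + C * (1 / (1 + D * w))) = (1 + D * w) / (1 + C + D * w)" if "w \<ge> 0" for w
  proof -
    have "1 + D * w > 0" using CD that by (simp add: add_pos_nonneg)
    then show ?thesis by (simp add: field_simps)
  qed
  have p1: "1 + C + D * z > 0" "1 + C + D * x > 0" using CD x by (simp_all add: add_pos_nonneg)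
  have xeq: "x = (1 + D * x) / (1 + C + D * x)"
  proof -
    have "y = 1 / (1 + D * x)" unfolding D_def mult.assoc by (rule fy)
    moreover have "x = 1 / (1 + C * y)" unfolding C_def mult.assoc by (rule fx)
    ultimately show ?thesis using two[OF less_imp_le[OF x]] by metis
  qed
  have "tree_ratio t (Suc (Suc n)) c d = (1 + D * z) / (1 + C + D * z)"
    using two[of z] CD by (simp add: C_def D_def z_def mult.assoc)
  then have "tree_ratio t (Suc (Suc n)) c d - x = (1 + D * z) / (1 + C + D * z) - (1 + D * x) / (1 + C + D * x)"
    using xeq by simp
  also have "\<dots> = C * D * (z - x) / ((1 + C + D * z) * (1 + C + D * x))"
    using p1 by (simp add: diff_frac_eq) (simp add: algebra_simps)
  finally have eq: "\<bar>tree_ratio t (Suc (Suc n)) c d - x\<bar> = C * D * \<bar>z - x\<bar> / ((1 + C + D * z) * (1 + C + D * x))"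
    using p1 CD by (simp add: abs_mult)
  have x1: "x \<le> 1" unfolding fx using t c y by (simp add: divide_le_eq)
  have "x * (1 + C + D * x) = 1 + D * x" using xeq p1 by (metis eq_divide_eq less_irrefl)
  then have "1 + C + D * x = 1 / x + D" using x by (simp add: field_simps)
  moreover have "1 / x \<ge> 1" using x x1 by simp
  ultimately have "1 + D \<le> 1 + C + D * x" by simp
  then have "(1 + C) * (1 + D) \<le> (1 + C + D * z) * (1 + C + D * x)"
    using CD by (intro mult_mono) auto
  then have "C * D * \<bar>z - x\<bar> / ((1 + C + D * z) * (1 + C + D * x)) \<le> C * D * \<bar>z - x\<bar> / ((1 + C) * (1 + D))"
    using CD by (intro divide_left_mono) (use x in \<open>auto intro!: mult_pos_pos add_pos_nonneg\<close>)
  then show ?thesis unfolding eq by (simp add: C_def D_def z_def)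
qed

text \<open>The offset \<open>j\<close> selects the even or the odd depths. Both subsequences have
  the same limit, so the lower and upper bounds on the ratios meet.\<close>

lemma tree_ratio_tendsto:
  assumes t: "t \<ge> 0" and c: "c \<ge> 0" and d: "d \<ge> 0" and x: "x > 0" and y: "y > 0"
    and fx: "x = 1 / (1 + t * (c * y))" and fy: "y = 1 / (1 + t * (d * x))"
  shows "(\<lambda>k. tree_ratio t (2 * k + j) c d) \<longlonglongrightarrow> x"
proof -
  define \<rho> where "\<rho> = (t * c) * (t * d) / ((1 + t * c) * (1 + t * d))"
  have "0 \<le> \<rho>" unfolding \<rho>_def using t c d by auto
  have "\<rho> < 1"
  proof -
    have "(t * c) * (t * d) < (1 + t * c) * (1 + t * d)"
      using t c d by (intro mult_strict_mono) (auto intro!: add_pos_nonneg)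
    then show ?thesis unfolding \<rho>_def using t c d
      by (simp add: divide_less_eq add_pos_nonneg)
  qed
  have bound: "\<bar>tree_ratio t (2 * k + j) c d - x\<bar> \<le> \<rho> ^ k * \<bar>tree_ratio t j c d - x\<bar>" for k
  proof (induction k)
    case (Suc k)
    have "\<bar>tree_ratio t (2 * Suc k + j) c d - x\<bar> \<le> \<rho> * \<bar>tree_ratio t (2 * k + j) c d - x\<bar>"
      using tree_ratio_contraction[OF assms, of "2 * k + j"] unfolding \<rho>_def by simp
    also have "\<dots> \<le> \<rho> * (\<rho> ^ k * \<bar>tree_ratio t j c d - x\<bar>)"
      using Suc \<open>0 \<le> \<rho>\<close> by (rule mult_left_mono)
    finally show ?case by (simp add: mult.assoc)
  qed simp
  have lim: "(\<lambda>k. \<rho> ^ k * \<bar>tree_ratio t j c d - x\<bar>) \<longlonglongrightarrow> 0"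
    using LIMSEQ_realpow_zero[OF \<open>0 \<le> \<rho>\<close> \<open>\<rho> < 1\<close>] by (rule tendsto_mult_left_zero)
  have "(\<lambda>k. tree_ratio t (2 * k + j) c d - x) \<longlonglongrightarrow> 0"
    by (rule Lim_null_comparison[OF _ lim]) (simp add: bound)
  then show ?thesis by (rule LIM_zero_cancel)
qed

section \<open>Monotonicity of the matching density\<close>

lemma biregular_bipartite_biregular:
  assumes "biregular_bipartite a b G"
  obtains A B where "biregular (edges G) A B a b" "A \<inter> B = {}" "A \<union> B = verts G"
    "finite A" "finite B" "\<forall>e\<in>edges G. card e = 2 \<and> e \<subseteq> verts G"
proof -
  obtain A B where AB: "A \<inter> B = {}" "A \<union> B = verts G"
    "\<forall>e\<in>edges G. \<exists>x\<in>A. \<exists>y\<in>B. e = {x, y}"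
    "\<forall>x\<in>A. degree G x = a" "\<forall>y\<in>B. degree G y = b" and fin: "finite (verts G)"
    using assms unfolding biregular_bipartite_def simple_graph_def by blast
  have e: "\<forall>e\<in>edges G. card e = 2 \<and> e \<subseteq> verts G"
  proof
    fix e assume "e \<in> edges G"
    then obtain x y where "x \<in> A" "y \<in> B" "e = {x, y}" using AB(3) by blast
    moreover have "x \<noteq> y" using AB(1) calculation by blast
    ultimately show "card e = 2 \<and> e \<subseteq> verts G" using AB(2) by auto
  qed
  have "edges G \<subseteq> Pow (verts G)" using e by blast
  then have "finite (edges G)" using fin by (simp add: finite_subset)
  moreover have "degree G v = card (nbr (edges G) v)" for v
    unfolding degree_def using e by (intro card_edges_at) blast
  ultimately have "biregular (edges G) A B a b"
    using AB by (simp add: biregular_def)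
  moreover have "finite A" "finite B" using fin AB(2) by (metis finite_Un)+
  ultimately show ?thesis using that AB e by blast
qed

text \<open>Double counting of incidences, as every edge has exactly one end in \<open>A\<close>.
  Used for both classes, it determines their proportion.\<close>

lemma biregular_card_edges:
  assumes "biregular E A B a b" "finite A"
  shows "a * card A = card E"
proof -
  have fin: "finite E" using assms(1) by (rule biregular_finite)
  have one: "card {x \<in> A. x \<in> e} = 1" if e: "e \<in> E" for e
  proof -
    obtain x y where "x \<in> A" "y \<in> B" "e = {x, y}" using assms(1) e unfolding biregular_def by blast
    then have "{z \<in> A. z \<in> e} = {x}" using assms(1) unfolding biregular_def by auto
    then show ?thesis by simp
  qed
  have "card {e \<in> E. x \<in> e} = a" if "x \<in> A" for x
    using card_edges_at[OF biregular_card2[OF assms(1)], of x] assms(1) that by (simp add: biregular_def)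
  then have "a * card A = (\<Sum>x\<in>A. card {e \<in> E. x \<in> e})" by simp
  also have "\<dots> = 1 * card E"
    by (rule sum_multicount) (use assms fin one in auto)
  finally show ?thesis by simp
qed

text \<open>This is t times the derivative of \<open>mgf\<close>; divided by \<open>mgf\<close> it
  is the mean size of a random matching.\<close>

definition size_mgf :: "'a set set \<Rightarrow> real \<Rightarrow> real" where
  "size_mgf E t = (\<Sum>M\<in>matchings E. real (card M) * t ^ card M)"

lemma times_derivative_mgf:
  "t * (\<Sum>M\<in>matchings E. real (card M) * t ^ (card M - Suc 0)) = size_mgf E t" for t :: real
proof -
  have "t * (real (card M) * t ^ (card M - Suc 0)) = real (card M) * t ^ card M" for M :: "'a set set"
    by (cases "card M") auto
  then show ?thesis unfolding size_mgf_def sum_distrib_left by (rule sum.cong[OF refl])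
qed

lemma match_poly_has_derivative:
  assumes "finite (edges G)"
  shows "(match_poly G has_real_derivative (\<Sum>M\<in>matchings (edges G). real (card M) * t ^ (card M - Suc 0))) (at t)"
proof -
  have "match_poly G = mgf (edges G)" using match_poly_eq_mgf[OF assms] by blast
  then show ?thesis by (simp add: mgf_has_derivative)
qed

lemma p_fun_eq_mgf:
  assumes "finite (edges G)"
  shows "p_fun G t = 2 * size_mgf (edges G) t / (card (verts G) * mgf (edges G) t)"
  unfolding p_fun_def match_poly_eq_mgf[OF assms] DERIV_imp_deriv[OF match_poly_has_derivative[OF assms]]
  by (simp add: mult.assoc times_derivative_mgf)

lemma p_fun_eq_ratio:
  assumes "finite (verts G)" "finite (edges G)" "\<forall>e\<in>edges G. card e = 2 \<and> e \<subseteq> verts G"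
    and "verts G \<noteq> {}" "t \<ge> 0"
  shows "p_fun G t = 1 - (\<Sum>v\<in>verts G. ratio (edges G) t v) / card (verts G)"
proof -
  have pos: "mgf (edges G) t > 0" using assms by (simp add: mgf_pos)
  have n: "real (card (verts G)) > 0" using assms by (simp add: card_gt_0_iff)
  have "(\<Sum>v\<in>verts G. ratio (edges G) t v) * mgf (edges G) t = (\<Sum>v\<in>verts G. mgf (remove_vertices (edges G) {v}) t)"
    using pos by (simp add: ratio_def sum_distrib_right)
  also have "\<dots> = card (verts G) * mgf (edges G) t - 2 * size_mgf (edges G) t"
    by (simp add: sum_mgf_remove_vertices[OF assms(1-3)] times_derivative_mgf mult.assoc)
  finally have "2 * size_mgf (edges G) t = (card (verts G) - (\<Sum>v\<in>verts G. ratio (edges G) t v)) * mgf (edges G) t"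
    by (simp add: algebra_simps)
  then show ?thesis
    unfolding p_fun_eq_mgf[OF assms(2)] using pos n by (simp add: field_simps)
qed

lemma p_fun_0: "p_fun G 0 = 0"
  by (simp add: p_fun_def)

lemma singleton_in_matchings: "e \<in> E \<Longrightarrow> {e} \<in> matchings E"
  by (simp add: matchings_def)

text \<open>Both factors have the sign of k - l. Writing the comparison with products instead of
  powers of t/s covers s = 0.\<close>

lemma power_swap_nonneg:
  fixes s t :: real
  assumes "0 \<le> s" "s \<le> t"
  shows "0 \<le> (real k - real l) * (t ^ k * s ^ l - s ^ k * t ^ l)"
proof -
  have le: "s ^ k * t ^ l \<le> t ^ k * s ^ l" if "l \<le> k" for k l
  proof -
    have "s ^ (k - l) \<le> t ^ (k - l)" using assms by (intro power_mono) auto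
    then have "s ^ (k - l) * (s ^ l * t ^ l) \<le> t ^ (k - l) * (s ^ l * t ^ l)"
      using assms by (intro mult_right_mono) auto
    moreover have "s ^ k = s ^ (k - l) * s ^ l" "t ^ k = t ^ (k - l) * t ^ l"
      using that by (simp_all flip: power_add)
    ultimately show ?thesis by (simp add: ac_simps)
  qed
  show ?thesis
  proof (cases "l \<le> k")
    case True
    then show ?thesis using le[of l k] by (intro mult_nonneg_nonneg) auto
  next
    case False
    then show ?thesis using le[of k l] by (intro mult_nonpos_nonpos) (auto simp: ac_simps)
  qed
qed

text \<open>Chebyshev's sum inequality for the mean matching size: twice the difference is a
  symmetrised double sum of terms that are nonnegative by \<open>power_swap_nonneg\<close>.
  Strictness comes from the pair of a single edge and the empty matching, which contributes t -
  s.\<close>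

lemma size_mgf_mgf_strict_mono:
  fixes E :: "'a set set"
  assumes fin: "finite E" and ne: "E \<noteq> {}" and st: "0 \<le> s" "s < t"
  shows "size_mgf E s * mgf E t < size_mgf E t * mgf E s"
proof -
  let ?X = "matchings E"
  let ?f = "\<lambda>(M :: 'a set set) (N :: 'a set set). (real (card M) - real (card N)) * (t ^ card M * s ^ card N - s ^ card M * t ^ card N)"
  have finX: "finite ?X" using fin by (rule finite_matchings)
  have f0: "0 \<le> ?f M N" for M N :: "'a set set" using st by (intro power_swap_nonneg) auto
  obtain e where e: "e \<in> E" using ne by blast
  have "0 < ?f {e} {}" using st by simp
  also have "\<dots> \<le> (\<Sum>N\<in>?X. ?f {e} N)"
    by (rule member_le_sum[OF empty_in_matchings f0 finX])
  also have "\<dots> \<le> (\<Sum>M\<in>?X. \<Sum>N\<in>?X. ?f M N)"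
    by (rule member_le_sum[OF singleton_in_matchings[OF e] sum_nonneg[OF f0] finX])
  also have "\<dots> = 2 * (size_mgf E t * mgf E s - size_mgf E s * mgf E t)"
  proof -
    \<comment> \<open>The second expansion is the first with the summation variables exchanged;
      adding both symmetrises the difference.\<close>
    have prods: "size_mgf E u * mgf E w = (\<Sum>M\<in>?X. \<Sum>N\<in>?X. real (card M) * (u ^ card M * w ^ card N))"
      "size_mgf E u * mgf E w = (\<Sum>M\<in>?X. \<Sum>N\<in>?X. real (card N) * (u ^ card N * w ^ card M))" for u w
    proof -
      show *: "size_mgf E u * mgf E w = (\<Sum>M\<in>?X. \<Sum>N\<in>?X. real (card M) * (u ^ card M * w ^ card N))"
        by (simp add: size_mgf_def mgf_def sum_product mult.assoc)
      show "size_mgf E u * mgf E w = (\<Sum>M\<in>?X. \<Sum>N\<in>?X. real (card N) * (u ^ card N * w ^ card M))"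
        unfolding * by (rule sum.swap)
    qed
    have "2 * (size_mgf E t * mgf E s - size_mgf E s * mgf E t)
      = (size_mgf E t * mgf E s + size_mgf E t * mgf E s) - (size_mgf E s * mgf E t + size_mgf E s * mgf E t)" by simp
    also have "\<dots> = ((\<Sum>M\<in>?X. \<Sum>N\<in>?X. real (card M) * (t ^ card M * s ^ card N))
        + (\<Sum>M\<in>?X. \<Sum>N\<in>?X. real (card N) * (t ^ card N * s ^ card M)))
      - ((\<Sum>M\<in>?X. \<Sum>N\<in>?X. real (card M) * (s ^ card M * t ^ card N))
        + (\<Sum>M\<in>?X. \<Sum>N\<in>?X. real (card N) * (s ^ card N * t ^ card M)))"
      using prods by metis
    also have "\<dots> = (\<Sum>M\<in>?X. \<Sum>N\<in>?X. ?f M N)"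
      unfolding sum.distrib[symmetric] sum_subtractf[symmetric]
      by (intro sum.cong) (auto simp: algebra_simps)
    finally show ?thesis by simp
  qed
  finally show ?thesis by simp
qed

lemma p_fun_strict_mono:
  assumes "finite (edges G)" "edges G \<noteq> {}" "card (verts G) > 0" "0 \<le> s" "s < t"
  shows "p_fun G s < p_fun G t"
proof -
  have pos: "mgf (edges G) s > 0" "mgf (edges G) t > 0" using assms by (simp_all add: mgf_pos)
  have "size_mgf (edges G) s / mgf (edges G) s < size_mgf (edges G) t / mgf (edges G) t"
    using size_mgf_mgf_strict_mono[OF assms(1,2,4,5)] pos by (simp add: frac_less_eq field_simps)
  then have "2 / card (verts G) * (size_mgf (edges G) s / mgf (edges G) s)
      < 2 / card (verts G) * (size_mgf (edges G) t / mgf (edges G) t)"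
    using assms(3) by (intro mult_strict_left_mono) auto
  then show ?thesis by (simp add: p_fun_eq_mgf[OF assms(1)])
qed

text \<open>The empty matching has positive weight and less than maximum size, so the mean size
  stays strictly below the maximum.\<close>

lemma p_fun_less_pstar:
  assumes fin: "finite (edges G)" and ne: "edges G \<noteq> {}" and n: "card (verts G) > 0" and t: "0 \<le> t"
  shows "p_fun G t < pstar G"
proof -
  let ?X = "matchings (edges G)"
  have X: "{card M |M. is_matching G M} = card ` ?X"
    by (auto simp: is_matching_def matchings_def pairwise_def disjnt_def)
  have finX: "finite ?X" using fin by (rule finite_matchings)
  have \<nu>: "card M \<le> match_num G" if "M \<in> ?X" for M
    unfolding match_num_def X using that finX by simp
  obtain e where "e \<in> edges G" using ne by blast
  then have \<nu>1: "1 \<le> match_num G" using \<nu>[OF singleton_in_matchings] by fastforce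
  have "0 < (\<Sum>M\<in>?X. (real (match_num G) - card M) * t ^ card M)"
    by (rule sum_pos2[of ?X "{}"]) (use finX empty_in_matchings \<nu>1 \<nu> t in \<open>auto\<close>)
  also have "\<dots> = match_num G * mgf (edges G) t - size_mgf (edges G) t"
    by (simp add: mgf_def size_mgf_def left_diff_distrib sum_subtractf sum_distrib_left)
  finally have "size_mgf (edges G) t < match_num G * mgf (edges G) t" by simp
  then show ?thesis
    unfolding p_fun_eq_mgf[OF fin] pstar_def
    using n mgf_pos[OF fin t] by (simp add: field_simps)
qed

lemma continuous_on_p_fun:
  assumes "finite (edges G)" "card (verts G) > 0"
  shows "continuous_on {0..} (p_fun G)"
proof -
  have "continuous_on {0..} (\<lambda>t. 2 * size_mgf (edges G) t / (card (verts G) * mgf (edges G) t))"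
    unfolding mgf_def[of "edges G", abs_def] size_mgf_def[of "edges G", abs_def]
    using mgf_pos[OF assms(1)] assms(2)
    by (intro continuous_intros) (fastforce simp: mgf_def)
  then show ?thesis unfolding p_fun_eq_mgf[OF assms(1), abs_def] .
qed

text \<open>Resolves the description in \<open>t_fun\<close>: existence by the intermediate value
  theorem, uniqueness by strict monotonicity. The interval in which the value is found also
  localises the inverse.\<close>

lemma t_fun_between:
  assumes "finite (edges G)" "edges G \<noteq> {}" "card (verts G) > 0"
    and st: "0 \<le> s" "s \<le> t" and p: "p_fun G s \<le> p" "p \<le> p_fun G t"
  shows "s \<le> t_fun G p" "t_fun G p \<le> t" "p_fun G (t_fun G p) = p"
proof -
  have "continuous_on {s..t} (p_fun G)"
    using continuous_on_p_fun[OF assms(1,3)] by (rule continuous_on_subset) (use st in auto)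
  from IVT'[OF p st(2) this] obtain u where u: "s \<le> u" "u \<le> t" "p_fun G u = p" by blast
  have "t_fun G p = u"
    unfolding t_fun_def
  proof (rule the_equality)
    show "0 \<le> u \<and> p_fun G u = p" using u st by simp
    fix w assume w: "0 \<le> w \<and> p_fun G w = p"
    show "w = u"
      using p_fun_strict_mono[OF assms(1-3), of u w] p_fun_strict_mono[OF assms(1-3), of w u] w u st
      by (cases w u rule: linorder_cases) auto
  qed
  then show "s \<le> t_fun G p" "t_fun G p \<le> t" "p_fun G (t_fun G p) = p" using u by simp_all
qed

section \<open>The limiting density\<close>

text \<open>\<open>f m\<close> is the density in the tree with the branches at the root cut off at
  depth m. The weights are crosswise, b/(a+b) for the class of degree a, because a * card A = b *
  card B.\<close>

lemma p_fun_bounds: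
  assumes G: "biregular_bipartite a b G" "verts G \<noteq> {}" and ab: "a > 0" "b > 0" and t: "t \<ge> 0"
    and cyc: "\<And>xs. is_cycle G xs \<Longrightarrow> length xs > n + 3" and n: "even n"
  defines "f \<equiv> \<lambda>m. 1 - b / (a + b) * (1 / (1 + t * (a * tree_ratio t m (real b - 1) (real a - 1))))
    - a / (a + b) * (1 / (1 + t * (b * tree_ratio t m (real a - 1) (real b - 1))))"
  shows "f n \<le> p_fun G t" "p_fun G t \<le> f (Suc n)"
proof -
  obtain A B where reg: "biregular (edges G) A B a b" and dis: "A \<inter> B = {}" and un: "A \<union> B = verts G"
    and fin: "finite A" "finite B" and e: "\<forall>e\<in>edges G. card e = 2 \<and> e \<subseteq> verts G"
    using biregular_bipartite_biregular[OF G(1)] .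
  note reg' = biregular_sym[OF reg]
  define N where "N = real (card (verts G))"
  have finV: "finite (verts G)" using fin un by (metis finite_Un)
  then have N0: "N > 0" using G(2) by (simp add: N_def card_gt_0_iff)
  have NAB: "N = card A + card B" unfolding N_def un[symmetric] using fin dis by (simp add: card_Un_disjoint)
  have "a * card A = b * card B" using biregular_card_edges[OF reg fin(1)] biregular_card_edges[OF reg' fin(2)] by simp
  then have "real a * card A = real b * card B" by (simp flip: of_nat_mult)
  then have "(real a + b) * card A = b * N" "(real a + b) * card B = a * N"
    unfolding NAB by (simp_all add: algebra_simps)
  then have w: "card A / N = b / (a + b)" "card B / N = a / (a + b)"
    using N0 ab by (simp_all add: field_simps)
  let ?r = "ratio (edges G) t"
  have p: "p_fun G t = 1 - (\<Sum>v\<in>A. ?r v) / N - (\<Sum>v\<in>B. ?r v) / N"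
    using p_fun_eq_ratio[OF finV biregular_finite[OF reg] e G(2) t] sum.union_disjoint[OF fin dis, of ?r]
    by (simp add: un N_def add_divide_distrib)
  define f1 where "f1 m = 1 / (1 + t * (a * tree_ratio t m (real b - 1) (real a - 1)))" for m
  define f2 where "f2 m = 1 / (1 + t * (b * tree_ratio t m (real a - 1) (real b - 1)))" for m
  have ab1: "a \<ge> 1" "b \<ge> 1" using ab by simp_all
  have "f1 (Suc n) \<le> ?r v \<and> ?r v \<le> f1 n" if "v \<in> A" for v
    unfolding f1_def using ratio_root_bounds[OF reg that t ab1 cyc n] by (simp del: tree_ratio.simps)
  then have "(\<Sum>v\<in>A. f1 (Suc n)) \<le> (\<Sum>v\<in>A. ?r v)" "(\<Sum>v\<in>A. ?r v) \<le> (\<Sum>v\<in>A. f1 n)"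
    by (auto intro!: sum_mono simp del: sum_constant)
  then have bA: "card A / N * f1 (Suc n) \<le> (\<Sum>v\<in>A. ?r v) / N" "(\<Sum>v\<in>A. ?r v) / N \<le> card A / N * f1 n"
    using N0 by (simp_all add: divide_right_mono)
  have "f2 (Suc n) \<le> ?r v \<and> ?r v \<le> f2 n" if "v \<in> B" for v
    unfolding f2_def using ratio_root_bounds[OF reg' that t ab1(2,1) cyc n] by (simp del: tree_ratio.simps)
  then have "(\<Sum>v\<in>B. f2 (Suc n)) \<le> (\<Sum>v\<in>B. ?r v)" "(\<Sum>v\<in>B. ?r v) \<le> (\<Sum>v\<in>B. f2 n)"
    by (auto intro!: sum_mono simp del: sum_constant)
  then have bB: "card B / N * f2 (Suc n) \<le> (\<Sum>v\<in>B. ?r v) / N" "(\<Sum>v\<in>B. ?r v) / N \<le> card B / N * f2 n"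
    using N0 by (simp_all add: divide_right_mono)
  show "f n \<le> p_fun G t" "p_fun G t \<le> f (Suc n)"
    using bA bB unfolding p f_def w f1_def[symmetric] f2_def[symmetric] of_nat_add by linarith+
qed

lemma p_fun_le_linear:
  assumes G: "biregular_bipartite a b G" "verts G \<noteq> {}" and t: "t \<ge> 0"
  shows "p_fun G t \<le> t * (a + b)"
proof -
  obtain A B where reg: "biregular (edges G) A B a b" and un: "A \<union> B = verts G"
    and fin: "finite A" "finite B" and e: "\<forall>e\<in>edges G. card e = 2 \<and> e \<subseteq> verts G"
    using biregular_bipartite_biregular[OF G(1)] .
  have finV: "finite (verts G)" using fin un by (metis finite_Un)
  then have N0: "real (card (verts G)) > 0" using G(2) by (simp add: card_gt_0_iff)
  have finE: "finite (edges G)" using reg by (rule biregular_finite)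
  have "1 - ratio (edges G) t v \<le> t * (a + b)" if "v \<in> verts G" for v
  proof -
    have "card (nbr (edges G) v) \<le> a + b"
      using that reg unfolding un[symmetric] biregular_def by auto
    then have "t * card (nbr (edges G) v) \<le> t * (a + b)" using t by (intro mult_left_mono) auto
    then show ?thesis using one_minus_ratio_le[OF finE biregular_card2[OF reg] t, of v] by linarith
  qed
  then have "(\<Sum>v\<in>verts G. 1 - ratio (edges G) t v) \<le> (\<Sum>v\<in>verts G. t * (a + b))"
    by (intro sum_mono) auto
  then have "card (verts G) - (\<Sum>v\<in>verts G. ratio (edges G) t v) \<le> card (verts G) * (t * (a + b))"
    by (simp add: sum_subtractf)
  then show ?thesis
    unfolding p_fun_eq_ratio[OF finV finE e G(2) t] using N0 by (simp add: field_simps)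
qed

text \<open>The index from which the bounds hold depends on k, so k is first fixed with
  \<open>l k\<close> or \<open>u k\<close> on the right side of the threshold, and only then i
  grows.\<close>

lemma tendsto_between_families:
  fixes l u :: "'k \<Rightarrow> real" and p :: "'i \<Rightarrow> real"
  assumes bd: "\<And>k. \<forall>\<^sub>F i in G. l k \<le> p i \<and> p i \<le> u k"
    and lim: "(l \<longlongrightarrow> L) F" "(u \<longlongrightarrow> L) F" and F: "F \<noteq> bot"
  shows "(p \<longlongrightarrow> L) G"
proof (rule order_tendstoI)
  fix c assume "c < L"
  from eventually_happens'[OF F order_tendstoD(1)[OF lim(1) this]] obtain k where "c < l k" by blast
  with bd[of k] show "\<forall>\<^sub>F i in G. c < p i" by (auto elim!: eventually_mono)
next
  fix c assume "L < c"
  from eventually_happens'[OF F order_tendstoD(2)[OF lim(2) this]] obtain k where "u k < c" by blast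
  with bd[of k] show "\<forall>\<^sub>F i in G. p i < c" by (auto elim!: eventually_mono)
qed

section \<open>Parametrisation by the edge probability q\<close>

definition activity :: "real \<Rightarrow> real \<Rightarrow> real \<Rightarrow> real" where
  "activity a b q = q * (1 - q) / ((1 - a * q) * (1 - b * q))"

locale large_girth_sequence =
  fixes a b :: nat and Gs :: "nat \<Rightarrow> graph"
  assumes apos: "a > 0" and bpos: "b > 0"
    and breg: "\<And>i. biregular_bipartite a b (Gs i)"
    and nonempty: "\<And>i. verts (Gs i) \<noteq> {}"
    and girth_inf: "\<And>n::nat. \<forall>\<^sub>F i in sequentially. enat n \<le> girth (Gs i)"
begin

text \<open>The range in which both covering probabilities aq and bq stay below 1; in terms of p it
  is 0 \<le> p < p0.\<close>

definition adm :: "real set" where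
  "adm = {q. 0 \<le> q \<and> a * q < 1 \<and> b * q < 1}"

lemma admD:
  fixes q :: real
  assumes "q \<in> adm"
  shows "0 \<le> q" "a * q < 1" "b * q < 1" "q < 1"
proof -
  show *: "0 \<le> q" "a * q < 1" "b * q < 1" using assms by (auto simp: adm_def)
  have "1 * q \<le> a * q" using * apos by (intro mult_right_mono) auto
  then show "q < 1" using * by simp
qed

lemma activity_nonneg: "q \<in> adm \<Longrightarrow> activity a b q \<ge> 0"
  using admD[of q] by (auto simp: activity_def)

lemma activity_pos: "q \<in> adm \<Longrightarrow> q > 0 \<Longrightarrow> activity a b q > 0"
  using admD[of q] by (auto simp: activity_def)

lemma no_short_cycles: "\<forall>\<^sub>F i in sequentially. \<forall>xs. is_cycle (Gs i) xs \<longrightarrow> length xs > K"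
  using girth_inf[of "Suc K"]
proof (rule eventually_mono)
  fix i assume g: "enat (Suc K) \<le> girth (Gs i)"
  have "girth (Gs i) \<le> enat (length xs)" if "is_cycle (Gs i) xs" for xs
    unfolding girth_def using that by (intro Inf_lower) blast
  then show "\<forall>xs. is_cycle (Gs i) xs \<longrightarrow> length xs > K"
    using g by (metis Suc_le_lessD enat_ord_simps(1) order_trans)
qed

lemma p_fun_tendsto:
  assumes q: "q \<in> adm"
  shows "(\<lambda>i. p_fun (Gs i) (activity a b q)) \<longlonglongrightarrow> 2 * real a * real b / (real a + real b) * q"
proof -
  \<comment> \<open>The limits of the ratio at a vertex that has lost its parent, for a vertex of
    degree a and of degree b respectively.\<close>
  define t x y where "t = activity a b q" and "x = (1 - a * q) / (1 - q)" and "y = (1 - b * q) / (1 - q)"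
  note qs = admD[OF q]
  have t0: "t \<ge> 0" using activity_nonneg[OF q] by (simp add: t_def)
  have xy: "x > 0" "y > 0" using qs by (simp_all add: x_def y_def)
  have nz: "1 - q \<noteq> 0" "1 - a * q \<noteq> 0" "1 - b * q \<noteq> 0" using qs by auto
  have ty: "t * y = q / (1 - a * q)" and tx: "t * x = q / (1 - b * q)"
    using nz by (simp_all add: t_def y_def x_def activity_def)
  have fx: "x = 1 / (1 + t * ((real a - 1) * y))"
  proof -
    have "1 + t * ((real a - 1) * y) = 1 + (real a - 1) * (q / (1 - a * q))" unfolding ty[symmetric] by simp
    also have "\<dots> = (1 - q) / (1 - a * q)" using nz by (simp add: field_simps)
    finally show ?thesis by (simp add: x_def)
  qed
  have fy: "y = 1 / (1 + t * ((real b - 1) * x))"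
  proof -
    have "1 + t * ((real b - 1) * x) = 1 + (real b - 1) * (q / (1 - b * q))" unfolding tx[symmetric] by simp
    also have "\<dots> = (1 - q) / (1 - b * q)" using nz by (simp add: field_simps)
    finally show ?thesis by (simp add: y_def)
  qed
  have a1: "real a - 1 \<ge> 0" "real b - 1 \<ge> 0" using apos bpos by simp_all
  define f where "f m = 1 - b / (a + b) * (1 / (1 + t * (a * tree_ratio t m (real b - 1) (real a - 1))))
    - a / (a + b) * (1 / (1 + t * (b * tree_ratio t m (real a - 1) (real b - 1))))" for m
  define L where "L = 1 - b / (a + b) * (1 / (1 + t * (a * y))) - a / (a + b) * (1 / (1 + t * (b * x)))"
  have lim: "(\<lambda>k. f (2 * k + j)) \<longlonglongrightarrow> L" for j
    unfolding f_def L_def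
    using t0 xy
    by (intro tendsto_intros tree_ratio_tendsto[OF t0 a1 xy fx fy] tree_ratio_tendsto[OF t0 a1(2,1) xy(2,1) fy fx])
      (auto intro!: add_pos_nonneg less_imp_neq[symmetric])
  have "\<forall>\<^sub>F i in sequentially. f (2 * k) \<le> p_fun (Gs i) t \<and> p_fun (Gs i) t \<le> f (2 * k + 1)" for k
    using no_short_cycles[of "2 * k + 3"]
  proof (rule eventually_mono)
    fix i assume c: "\<forall>xs. is_cycle (Gs i) xs \<longrightarrow> length xs > 2 * k + 3"
    show "f (2 * k) \<le> p_fun (Gs i) t \<and> p_fun (Gs i) t \<le> f (2 * k + 1)"
      using p_fun_bounds[OF breg nonempty apos bpos t0, of i "2 * k"] c
      unfolding f_def by (simp del: tree_ratio.simps)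
  qed
  from tendsto_between_families[OF this lim[of 0, simplified] lim[of 1]]
  have "(\<lambda>i. p_fun (Gs i) t) \<longlonglongrightarrow> L" by simp
  moreover have "L = 2 * real a * real b / (real a + real b) * q"
  proof -
    \<comment> \<open>At the root all a branches count instead of a - 1, and the ratio becomes the
      uncovered probability 1 - aq itself.\<close>
    have "1 + t * (a * y) = 1 + a * (q / (1 - a * q))" unfolding ty[symmetric] by simp
    also have "\<dots> = 1 / (1 - a * q)" using nz by (simp add: field_simps)
    finally have A: "1 / (1 + t * (a * y)) = 1 - a * q" by simp
    have "1 + t * (b * x) = 1 + b * (q / (1 - b * q))" unfolding tx[symmetric] by simp
    also have "\<dots> = 1 / (1 - b * q)" using nz by (simp add: field_simps)
    finally have B: "1 / (1 + t * (b * x)) = 1 - b * q" by simp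
    define s where "s = real a + real b"
    have "b / s + a / s = 1" unfolding s_def using apos by (simp flip: add_divide_distrib)
    moreover have "L = 1 - (b / s + a / s) + 2 * real a * real b / s * q"
      unfolding L_def A B of_nat_add s_def[symmetric] by (simp add: algebra_simps)
    ultimately show ?thesis by (simp add: s_def)
  qed
  ultimately show ?thesis by (simp add: t_def)
qed

text \<open>Clearing denominators in activity = t gives P q^2 - S q + t = 0 with discriminant
  \<open>D\<close>. The smaller root is taken: it is 0 at t = 0, where the other root is 1.\<close>

lemma ex_activity:
  assumes t: "t \<ge> 0"
  defines "q \<equiv> ((real a + b) * t + 1 - sqrt (1 + (2 * real a + 2 * real b - 4) * t + (real a - real b)\<^sup>2 * t\<^sup>2))
      / (2 * (real a * b * t + 1))"
  shows "q \<in> adm" "activity a b q = t"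
proof -
  define D where "D = 1 + (2 * real a + 2 * real b - 4) * t + (real a - real b)\<^sup>2 * t\<^sup>2"
  define S where "S = (real a + b) * t + 1"
  define P where "P = real a * b * t + 1"
  have P0: "P > 0" unfolding P_def using t by (simp add: add_nonneg_pos)
  have a1: "real a \<ge> 1" "real b \<ge> 1" using apos bpos by simp_all
  have D: "D = S\<^sup>2 - 4 * t * P" unfolding D_def S_def P_def by (simp add: power2_eq_square algebra_simps)
  have D0: "D \<ge> 0" unfolding D_def using t a1 by (intro add_nonneg_nonneg mult_nonneg_nonneg) auto
  have S0: "S > 0" unfolding S_def using t by (simp add: add_nonneg_pos)
  have q: "q = (S - sqrt D) / (2 * P)" by (simp add: q_def D_def S_def P_def)
  have "sqrt D \<le> S" using D0 S0 t P0 by (intro real_le_lsqrt) (auto simp: D)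
  then have q0: "q \<ge> 0" using P0 by (simp add: q)
  \<comment> \<open>Stated for fresh a and b so that it can be applied again with the two degrees
    exchanged.\<close>
  have lt: "a * q < 1" if ab: "real a \<ge> 1" "real b \<ge> 1" "D = S\<^sup>2 - 4 * t * P"
      "S = (real a + b) * t + 1" "P = real a * b * t + 1" for a b :: nat
  proof -
    have "a * S - 2 * P < a * sqrt D"
    proof (cases "a * S - 2 * P < 0")
      case True
      moreover have "a * sqrt D \<ge> 0" using D0 by simp
      ultimately show ?thesis by linarith
    next
      case False
      \<comment> \<open>The difference of the squares vanishes for a = 1; that case is excluded
        because \<open>a * S - 2 * P\<close> is then negative.\<close>
      have id: "a\<^sup>2 * D - (a * S - 2 * P)\<^sup>2 = 4 * P * (real a - 1)"
        unfolding ab(3-5) by (simp add: power2_eq_square algebra_simps)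
      have "a \<noteq> 1"
      proof
        assume "a = 1"
        then have "a * S - 2 * P = t * (1 - real b) - 1" unfolding ab(4,5) by (simp add: algebra_simps)
        moreover have "t * (1 - real b) \<le> 0" using t ab by (simp add: mult_nonneg_nonpos)
        ultimately show False using False by linarith
      qed
      then have "real a - 1 > 0" using ab(1) by simp
      then have "(a * S - 2 * P)\<^sup>2 < a\<^sup>2 * D" using id P0 by (smt (verit) mult_pos_pos)
      then have "(a * S - 2 * P)\<^sup>2 < (a * sqrt D)\<^sup>2" using D0 by (simp add: power_mult_distrib)
      then show ?thesis by (rule power2_less_imp_less) (use D0 in simp)
    qed
    then have "a * (S - sqrt D) < 2 * P" by (simp add: right_diff_distrib)
    then show ?thesis unfolding q using P0 by simp
  qed
  have "a * q < 1" by (rule lt[OF a1 D S_def P_def])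
  moreover have "S = (real b + a) * t + 1" "P = real b * a * t + 1"
    by (simp_all add: S_def P_def add.commute mult.commute)
  then have "b * q < 1" by (rule lt[OF a1(2,1) D])
  ultimately show adm: "q \<in> adm" using q0 by (simp add: adm_def)
  have nz: "1 - a * q \<noteq> 0" "1 - b * q \<noteq> 0" using admD[OF adm] by auto
  have "2 * P * q = S - sqrt D" using P0 by (simp add: q)
  then have "(S - 2 * P * q)\<^sup>2 = D" using D0 by simp
  then have "4 * P * (P * q\<^sup>2 - S * q + t) = 0" unfolding D by (simp add: power2_eq_square algebra_simps)
  then have "P * q\<^sup>2 - S * q + t = 0" using P0 by simp
  then have "t * ((1 - a * q) * (1 - b * q)) = q * (1 - q)"
    unfolding P_def S_def by (simp add: power2_eq_square algebra_simps)
  then show "activity a b q = t" unfolding activity_def using nz by (simp add: divide_eq_eq)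
qed

end

section \<open>The limiting free energy\<close>

definition free_energy :: "graph \<Rightarrow> real \<Rightarrow> real" where
  "free_energy G t = ln (match_poly G t) / card (verts G)"

lemma mgf_0:
  assumes "finite E"
  shows "mgf E 0 = 1"
proof -
  have "(0::real) ^ card M = (if M = {} then 1 else 0)" if "M \<in> matchings E" for M
  proof -
    have "finite M" using that assms finite_subset by (auto simp: matchings_def)
    then show ?thesis by (simp add: card_gt_0_iff)
  qed
  then have "mgf E 0 = (\<Sum>M\<in>matchings E. if M = {} then 1 else 0)"
    unfolding mgf_def by (rule sum.cong[OF refl])
  also have "\<dots> = 1" using finite_matchings[OF assms] empty_in_matchings by simp
  finally show ?thesis .
qed

lemma free_energy_0: "finite (edges G) \<Longrightarrow> free_energy G 0 = 0"
  by (simp add: free_energy_def match_poly_eq_mgf mgf_0)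

text \<open>Includes t = 0, where p/(2t) is 0/0 and evaluates to 0 instead of the derivative. It
  supplies continuity up to 0.\<close>

lemma free_energy_has_derivative:
  assumes "finite (edges G)" "t \<ge> 0"
  shows "(free_energy G has_real_derivative deriv (match_poly G) t / match_poly G t / card (verts G)) (at t)"
proof -
  have "(match_poly G has_real_derivative deriv (match_poly G) t) (at t)"
    using match_poly_has_derivative[OF assms(1)] DERIV_imp_deriv by metis
  moreover have "match_poly G t > 0" using assms by (simp add: match_poly_eq_mgf mgf_pos)
  ultimately have "((\<lambda>t. ln (match_poly G t)) has_real_derivative deriv (match_poly G) t / match_poly G t) (at t)"
    by (auto intro!: derivative_eq_intros)
  from DERIV_cdivide[OF this] show ?thesis by (simp add: free_energy_def[abs_def])
qed

lemma free_energy_has_derivative_pos: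
  assumes "finite (edges G)" "t > 0"
  shows "(free_energy G has_real_derivative p_fun G t / (2 * t)) (at t)"
proof -
  have "p_fun G t / (2 * t) = deriv (match_poly G) t / match_poly G t / card (verts G)"
    using assms(2) by (simp add: p_fun_def)
  then show ?thesis using free_energy_has_derivative[of G t] assms by simp
qed

context large_girth_sequence
begin

lemma graph_facts:
  shows finite_edges: "finite (edges (Gs i))" and edges_nonempty: "edges (Gs i) \<noteq> {}"
    and card_verts_pos: "card (verts (Gs i)) > 0"
proof -
  obtain A B where reg: "biregular (edges (Gs i)) A B a b" and un: "A \<union> B = verts (Gs i)"
    and fin: "finite A" "finite B"
    using biregular_bipartite_biregular[OF breg[of i]] .
  show "finite (edges (Gs i))" using reg by (rule biregular_finite)
  have "finite (verts (Gs i))" using fin un by (metis finite_Un)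
  then show "card (verts (Gs i)) > 0" using nonempty[of i] by (simp add: card_gt_0_iff)
  show "edges (Gs i) \<noteq> {}"
  proof
    assume "edges (Gs i) = {}"
    then have "a * card A = 0" "b * card B = 0"
      using biregular_card_edges[OF reg fin(1)] biregular_card_edges[OF biregular_sym[OF reg] fin(2)] by simp_all
    then have "A = {}" "B = {}" using apos bpos fin by simp_all
    then show False using un nonempty[of i] by simp
  qed
qed

lemmas p_fun_mono = p_fun_strict_mono[OF finite_edges edges_nonempty card_verts_pos]

lemma p_fun_nonneg: "t \<ge> 0 \<Longrightarrow> p_fun (Gs i) t \<ge> 0"
  using p_fun_mono[of 0 t i] p_fun_0[of "Gs i"] by (cases "t = 0") auto

lemma abs_half_p_fun_le:
  assumes "t > 0"
  shows "\<bar>p_fun (Gs i) t / (2 * t)\<bar> \<le> (a + b) / 2"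
  using assms p_fun_nonneg[of t i] p_fun_le_linear[OF breg nonempty, of t i]
  by (simp add: field_simps)

text \<open>The constant is the same for all i, which allows an argument that itself varies with i
  to be replaced by its limit.\<close>

lemma free_energy_lipschitz:
  assumes "s > 0" "t > 0"
  shows "\<bar>free_energy (Gs i) s - free_energy (Gs i) t\<bar> \<le> (a + b) / 2 * \<bar>s - t\<bar>"
proof -
  have "norm (free_energy (Gs i) s - free_energy (Gs i) t) \<le> (a + b) / 2 * norm (s - t)"
  proof (rule field_differentiable_bound[of "{0<..}" _ "\<lambda>t. p_fun (Gs i) t / (2 * t)"])
    fix t :: real assume "t \<in> {0<..}"
    then have "t > 0" by simp
    then show "norm (p_fun (Gs i) t / (2 * t)) \<le> (a + b) / 2"
      using abs_half_p_fun_le by simp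
    show "(free_energy (Gs i) has_field_derivative p_fun (Gs i) t / (2 * t)) (at t within {0<..})"
      using free_energy_has_derivative_pos[OF finite_edges \<open>t > 0\<close>] by (rule DERIV_subset) simp
  qed (use assms in auto)
  then show ?thesis by simp
qed

text \<open>The antiderivative, vanishing at 0, of ab/(a+b) * q * t'(q)/t(q), where p/2 = ab/(a+b) *
  q.\<close>

definition free_energy_limit :: "real \<Rightarrow> real" where
  "free_energy_limit q = a * b / (a + b) * ln (1 - q) - a / (a + b) * ln (1 - real b * q) - b / (a + b) * ln (1 - real a * q)"

definition activity_deriv :: "real \<Rightarrow> real" where
  "activity_deriv q = ((1 - 2 * q) * ((1 - real a * q) * (1 - real b * q))
      + q * (1 - q) * (real a * (1 - real b * q) + real b * (1 - real a * q)))
    / ((1 - real a * q) * (1 - real b * q))\<^sup>2"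

lemma activity_has_derivative:
  fixes q :: real
  assumes "q \<in> adm"
  shows "(activity a b has_real_derivative activity_deriv q) (at q)"
proof -
  have "(1 - a * q) * (1 - b * q) \<noteq> 0" using admD[OF assms] by auto
  then show ?thesis
    unfolding activity_def[abs_def] activity_deriv_def
    by (auto intro!: derivative_eq_intros simp: power2_eq_square algebra_simps)
qed

lemma free_energy_limit_has_derivative:
  fixes q :: real
  assumes "q \<in> adm"
  shows "(free_energy_limit has_real_derivative a * b / (a + b) * (1 / (1 - a * q) + 1 / (1 - b * q) - 1 / (1 - q))) (at q)"
proof -
  define A B C where "A = 1 - a * q" and "B = 1 - b * q" and "C = 1 - q"
  have pos: "A > 0" "B > 0" "C > 0" using admD[OF assms] by (auto simp: A_def B_def C_def)
  have 1: "((\<lambda>q. ln (1 - q)) has_real_derivative - (1 / C)) (at q)"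
    using pos unfolding C_def by (auto intro!: derivative_eq_intros)
  have 2: "((\<lambda>q. ln (1 - real b * q)) has_real_derivative - (b * (1 / B))) (at q)"
    using pos unfolding B_def by (auto intro!: derivative_eq_intros)
  have 3: "((\<lambda>q. ln (1 - real a * q)) has_real_derivative - (a * (1 / A))) (at q)"
    using pos unfolding A_def by (auto intro!: derivative_eq_intros)
  have "(free_energy_limit has_real_derivative a * b / (a + b) * - (1 / C) - a / (a + b) * - (b * (1 / B))
      - b / (a + b) * - (a * (1 / A))) (at q)"
    unfolding free_energy_limit_def[abs_def] by (intro DERIV_diff DERIV_cmult 1 2 3)
  also have "a * b / (a + b) * - (1 / C) - a / (a + b) * - (b * (1 / B)) - b / (a + b) * - (a * (1 / A))
      = a * b / (a + b) * (1 / A + 1 / B - 1 / C)"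
    by (simp add: algebra_simps add_divide_distrib diff_divide_distrib)
  finally show ?thesis by (simp only: A_def B_def C_def)
qed

text \<open>The logarithmic derivative of the activity is 1/q - 1/(1 - q) + a/(1 - aq) + b/(1 - bq).
  Multiply by q and use aq/(1 - aq) = 1/(1 - aq) - 1, and likewise for b and for 1 - q.\<close>

lemma free_energy_limit_derivative_eq:
  fixes q :: real
  assumes "q \<in> adm" "q > 0"
  shows "1 / (1 - a * q) + 1 / (1 - b * q) - 1 / (1 - q) = q / activity a b q * activity_deriv q"
proof -
  define A B C where "A = 1 - a * q" and "B = 1 - b * q" and "C = 1 - q"
  have pos: "A > 0" "B > 0" "C > 0" using admD[OF assms(1)] by (auto simp: A_def B_def C_def)
  have "q / activity a b q * activity_deriv q = ((1 - 2 * q) * (A * B) + q * C * (a * B + b * A)) / (C * A * B)"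
    unfolding activity_def activity_deriv_def A_def[symmetric] B_def[symmetric] C_def[symmetric]
    using pos assms(2) by (simp add: power2_eq_square)
  also have "(1 - 2 * q) * (A * B) + q * C * (a * B + b * A) = B * C + A * C - A * B"
    unfolding A_def B_def C_def by (simp add: algebra_simps)
  also have "(B * C + A * C - A * B) / (C * A * B) = 1 / A + 1 / B - 1 / C"
    using pos by (simp add: field_simps)
  finally show ?thesis by (simp add: A_def B_def C_def)
qed

lemma adm_downward:
  fixes q r :: real
  assumes "q \<in> adm" "0 \<le> r" "r \<le> q"
  shows "r \<in> adm"
proof -
  have "a * r \<le> a * q" "b * r \<le> b * q" using assms by (auto intro: mult_left_mono)
  then show ?thesis using assms by (auto simp: adm_def)
qed

lemma free_energy_tendsto:
  assumes Q: "Q \<in> adm"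
  shows "(\<lambda>i. free_energy (Gs i) (activity a b Q)) \<longlonglongrightarrow> free_energy_limit Q"
proof -
  have adm: "q \<in> adm" if "q \<in> {0..Q}" for q using adm_downward[OF Q] that by auto
  have Q0: "0 \<le> Q" using admD[OF Q] by simp
  have cont_activity: "continuous_on {0..Q} (activity a b)"
    by (rule DERIV_continuous_on) (use activity_has_derivative adm DERIV_subset in blast)
  \<comment> \<open>The activity vanishes at q = 0, so the integrands get the value 0 there. The
    fundamental theorem asks for derivatives only in the open interval, so this value is
    free.\<close>
  define f where "f i q = (if q = 0 then 0 else p_fun (Gs i) (activity a b q) / (2 * activity a b q) * activity_deriv q)" for i q
  define g where "g q = (if q = 0 then 0 else a * b / (a + b) * (q / activity a b q * activity_deriv q))" for q
  have fi: "(f i has_integral free_energy (Gs i) (activity a b Q)) {0..Q}" for i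
  proof -
    have "(f i has_integral free_energy (Gs i) (activity a b Q) - free_energy (Gs i) (activity a b 0)) {0..Q}"
    proof (rule fundamental_theorem_of_calculus_interior[OF Q0])
      have "continuous_on {0..} (free_energy (Gs i))"
        by (rule DERIV_continuous_on)
          (use free_energy_has_derivative[OF finite_edges] DERIV_subset in \<open>blast intro: atLeast_iff[THEN iffD1]\<close>)
      then show "continuous_on {0..Q} (\<lambda>q. free_energy (Gs i) (activity a b q))"
        by (rule continuous_on_compose2[OF _ cont_activity]) (use activity_nonneg adm in auto)
      fix q assume q: "q \<in> {0<..<Q}"
      then have q': "q \<in> adm" "q > 0" using adm by auto
      have "((\<lambda>q. free_energy (Gs i) (activity a b q)) has_real_derivative
          p_fun (Gs i) (activity a b q) / (2 * activity a b q) * activity_deriv q) (at q)"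
        by (rule DERIV_chain2[OF free_energy_has_derivative_pos activity_has_derivative])
          (use q' activity_pos finite_edges in auto)
      then show "((\<lambda>q. free_energy (Gs i) (activity a b q)) has_vector_derivative f i q) (at q)"
        using q' by (simp add: f_def has_real_derivative_iff_has_vector_derivative)
    qed
    then show ?thesis by (simp add: activity_def free_energy_0[OF finite_edges])
  qed
  have gi: "(g has_integral free_energy_limit Q) {0..Q}"
  proof -
    have "(g has_integral free_energy_limit Q - free_energy_limit 0) {0..Q}"
    proof (rule fundamental_theorem_of_calculus_interior[OF Q0])
      show "continuous_on {0..Q} free_energy_limit"
        by (rule DERIV_continuous_on) (use free_energy_limit_has_derivative adm DERIV_subset in blast)
      fix q assume q: "q \<in> {0<..<Q}"
      then have q': "q \<in> adm" "q > 0" using adm by auto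
      show "(free_energy_limit has_vector_derivative g q) (at q)"
        using free_energy_limit_has_derivative[OF q'(1)] free_energy_limit_derivative_eq[OF q'] q'(2)
        by (simp add: g_def has_real_derivative_iff_has_vector_derivative)
    qed
    then show ?thesis by (simp add: free_energy_limit_def)
  qed
  \<comment> \<open>With the denominator bounded away from 0 on the compact interval,
    \<open>activity_deriv\<close> has a bound \<open>K\<close>; together with the bound on p/(2t) it
    gives a constant majorant.\<close>
  have "((1 - real a * q) * (1 - real b * q))\<^sup>2 \<noteq> 0" if "q \<in> {0..Q}" for q
    using admD(2,3)[OF adm[OF that]] by simp
  then have "continuous_on {0..Q} activity_deriv"
    unfolding activity_deriv_def[abs_def] by (intro continuous_intros) blast
  then have "bounded (activity_deriv ` {0..Q})"
    by (intro compact_imp_bounded compact_continuous_image) auto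
  then obtain K where K: "\<bar>activity_deriv q\<bar> \<le> K" if "q \<in> {0..Q}" for q
    unfolding bounded_iff by (metis imageI real_norm_def)
  have "(\<lambda>i. integral {0..Q} (f i)) \<longlonglongrightarrow> integral {0..Q} g"
  proof (rule dominated_convergence(2)[where h = "\<lambda>_. (a + b) / 2 * K"])
    show "f i integrable_on {0..Q}" for i using fi by (rule has_integral_integrable)
    show "(\<lambda>_. (a + b) / 2 * K) integrable_on {0..Q}" by (rule integrable_const_ivl)
  next
    fix i q assume q: "q \<in> {0..Q}"
    have K0: "0 \<le> K" using K[OF q] by linarith
    show "norm (f i q) \<le> (a + b) / 2 * K"
    proof (cases "q = 0")
      case True
      then show ?thesis using K0 by (simp add: f_def)
    next
      case False
      then have "activity a b q > 0" using activity_pos adm[OF q] q by simp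
      then have "\<bar>p_fun (Gs i) (activity a b q) / (2 * activity a b q)\<bar> * \<bar>activity_deriv q\<bar> \<le> (a + b) / 2 * K"
        by (intro mult_mono abs_half_p_fun_le K[OF q]) auto
      then show ?thesis using False by (simp add: f_def abs_mult)
    qed
  next
    fix q assume q: "q \<in> {0..Q}"
    show "(\<lambda>i. f i q) \<longlonglongrightarrow> g q"
    proof (cases "q = 0")
      case False
      then have pos: "activity a b q > 0" using activity_pos adm[OF q] q by simp
      have "(\<lambda>i. p_fun (Gs i) (activity a b q) / (2 * activity a b q) * activity_deriv q)
          \<longlonglongrightarrow> (2 * real a * real b / (real a + real b) * q) / (2 * activity a b q) * activity_deriv q"
        using pos by (intro tendsto_intros p_fun_tendsto adm[OF q]) auto
      then show ?thesis using False by (simp add: f_def g_def mult.assoc)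
    qed (simp add: f_def g_def)
  qed
  then show ?thesis unfolding integral_unique[OF fi] integral_unique[OF gi] .
qed

section \<open>Convergence of the inverse functions and of lambda\<close>

text \<open>Inherited from the graphs instead of calculus: if the activities were in the wrong
  order, monotonicity of each \<open>p_fun (Gs i)\<close> would pass to the limit densities and
  force r \<le> q.\<close>

lemma activity_strict_mono:
  assumes "q \<in> adm" "r \<in> adm" "q < r"
  shows "activity a b q < activity a b r"
proof -
  have c: "2 * real a * real b / (real a + real b) > 0" using apos bpos by simp
  have "\<not> activity a b r \<le> activity a b q"
  proof
    assume le: "activity a b r \<le> activity a b q"
    have "p_fun (Gs i) (activity a b r) \<le> p_fun (Gs i) (activity a b q)" for i
      using p_fun_mono[of "activity a b r" "activity a b q" i] le activity_nonneg[OF assms(2)]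
      by (cases "activity a b r = activity a b q") auto
    then have "2 * real a * real b / (real a + real b) * r \<le> 2 * real a * real b / (real a + real b) * q"
      by (intro LIMSEQ_le[OF p_fun_tendsto[OF assms(2)] p_fun_tendsto[OF assms(1)]]) auto
    then show False using mult_strict_left_mono[OF assms(3) c] by simp
  qed
  then show ?thesis by simp
qed

text \<open>By \<open>ex_activity\<close>, t is itself the activity of some r. Comparing t with the
  activity of q thus compares r with q, and a strict gap between the limit densities persists for
  large i.\<close>

lemma p_fun_crosses:
  assumes q: "q \<in> adm" and t: "0 \<le> t"
  defines "p \<equiv> 2 * real a * real b / (real a + real b) * q"
  shows "t < activity a b q \<Longrightarrow> \<forall>\<^sub>F i in sequentially. p_fun (Gs i) t < p"
    and "activity a b q < t \<Longrightarrow> \<forall>\<^sub>F i in sequentially. p < p_fun (Gs i) t"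
proof -
  obtain r where r: "r \<in> adm" "activity a b r = t" using ex_activity[OF t] by blast
  have c: "2 * real a * real b / (real a + real b) > 0" using apos bpos by simp
  note lim = p_fun_tendsto[OF r(1), unfolded r(2)]
  show "\<forall>\<^sub>F i in sequentially. p_fun (Gs i) t < p" if "t < activity a b q"
  proof -
    have "r < q" using activity_strict_mono[OF q r(1)] r(2) that by (cases q r rule: linorder_cases) auto
    then show ?thesis using mult_strict_left_mono[OF _ c] unfolding p_def by (intro order_tendstoD(2)[OF lim]) blast
  qed
  show "\<forall>\<^sub>F i in sequentially. p < p_fun (Gs i) t" if "activity a b q < t"
  proof -
    have "q < r" using activity_strict_mono[OF r(1) q] r(2) that by (cases q r rule: linorder_cases) auto
    then show ?thesis using mult_strict_left_mono[OF _ c] unfolding p_def by (intro order_tendstoD(1)[OF lim]) blast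
  qed
qed

lemma t_fun_tendsto:
  assumes q: "q \<in> adm"
  defines "p \<equiv> 2 * real a * real b / (real a + real b) * q"
  shows "(\<lambda>i. t_fun (Gs i) p) \<longlonglongrightarrow> activity a b q"
    and "\<forall>\<^sub>F i in sequentially. t_fun (Gs i) p \<ge> 0 \<and> p_fun (Gs i) (t_fun (Gs i) p) = p"
proof -
  note between = t_fun_between[OF finite_edges edges_nonempty card_verts_pos]
  let ?t = "activity a b q"
  have c: "2 * real a * real b / (real a + real b) > 0" using apos bpos by simp
  have p0: "0 \<le> p" using admD(1)[OF q] c by (simp add: p_def)
  \<comment> \<open>The density is 0 at activity 0 and eventually exceeds p at u, which encloses the
    inverse in [0, u].\<close>
  have up: "\<forall>\<^sub>F i in sequentially. 0 \<le> t_fun (Gs i) p \<and> t_fun (Gs i) p \<le> u \<and> p_fun (Gs i) (t_fun (Gs i) p) = p"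
    if u: "?t < u" for u
  proof -
    have u0: "0 \<le> u" using activity_nonneg[OF q] u by simp
    from p_fun_crosses(2)[OF q u0 u] show ?thesis
    proof (rule eventually_mono)
      fix i assume "2 * real a * real b / (real a + real b) * q < p_fun (Gs i) u"
      then show "0 \<le> t_fun (Gs i) p \<and> t_fun (Gs i) p \<le> u \<and> p_fun (Gs i) (t_fun (Gs i) p) = p"
        using between[of 0 u i p] u0 p0 by (simp add: p_fun_0 p_def)
    qed
  qed
  show ev: "\<forall>\<^sub>F i in sequentially. t_fun (Gs i) p \<ge> 0 \<and> p_fun (Gs i) (t_fun (Gs i) p) = p"
    using up[of "?t + 1"] by (auto elim!: eventually_mono)
  show "(\<lambda>i. t_fun (Gs i) p) \<longlonglongrightarrow> ?t"
  proof (rule order_tendstoI)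
    fix s assume s: "s < ?t"
    show "\<forall>\<^sub>F i in sequentially. s < t_fun (Gs i) p"
    proof (cases "s < 0")
      case True
      then show ?thesis using ev by (auto elim!: eventually_mono)
    next
      case False
      then have "0 \<le> s" by simp
      from ev p_fun_crosses(1)[OF q this s, folded p_def] show ?thesis
      proof eventually_elim
        case (elim i)
        show ?case
        proof (rule ccontr)
          assume "\<not> s < t_fun (Gs i) p"
          then show False using elim p_fun_mono[of "t_fun (Gs i) p" s i] by (cases "t_fun (Gs i) p = s") auto
        qed
      qed
    qed
  next
    fix u assume u: "?t < u"
    \<comment> \<open>The midpoint is needed because \<open>up\<close> yields only a weak upper
      bound.\<close>
    then have "?t < (?t + u) / 2" "(?t + u) / 2 < u" by simp_all
    from up[OF this(1)] this(2) show "\<forall>\<^sub>F i in sequentially. t_fun (Gs i) p < u"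
      by (auto elim!: eventually_mono)
  qed
qed

text \<open>The free energy converges at a fixed activity, but here its argument
  \<open>t_fun (Gs i) p\<close> moves with i; the uniform Lipschitz bound closes the gap. For q = 0
  the logarithm of the activity has no limit to refer to, and \<open>lambda_open\<close> is 0 by
  convention.\<close>

lemma lambda_G_tendsto:
  assumes q: "q \<in> adm"
  defines "p \<equiv> 2 * real a * real b / (real a + real b) * q"
  shows "(\<lambda>i. lambda_G (Gs i) p) \<longlonglongrightarrow> (if q = 0 then 0 else free_energy_limit q - p / 2 * ln (activity a b q))"
proof -
  let ?t = "\<lambda>i. t_fun (Gs i) p"
  note t = t_fun_tendsto[OF q, folded p_def]
  have c: "2 * real a * real b / (real a + real b) > 0" using apos bpos by simp
  then have p0: "0 \<le> p" "p = 0 \<longleftrightarrow> q = 0" using admD(1)[OF q] by (auto simp: p_def)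
  \<comment> \<open>Once p is attained it lies below \<open>pstar\<close>, so
    \<open>lambda_G\<close> is in its first branch.\<close>
  have lam: "\<forall>\<^sub>F i in sequentially. lambda_open (Gs i) p = lambda_G (Gs i) p"
    using t(2)
  proof (rule eventually_mono)
    fix i assume *: "?t i \<ge> 0 \<and> p_fun (Gs i) (?t i) = p"
    then have "p < pstar (Gs i)"
      using p_fun_less_pstar[OF finite_edges edges_nonempty card_verts_pos, of "?t i" i] by simp
    then show "lambda_open (Gs i) p = lambda_G (Gs i) p" using p0 by (simp add: lambda_G_def)
  qed
  have "(\<lambda>i. lambda_open (Gs i) p) \<longlonglongrightarrow> (if q = 0 then 0 else free_energy_limit q - p / 2 * ln (activity a b q))"
  proof (cases "q = 0")
    case True
    then show ?thesis using p0 by (simp add: lambda_open_def)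
  next
    case False
    then have pos: "activity a b q > 0" using activity_pos[OF q] admD[OF q] by simp
    have "(\<lambda>i. (a + b) / 2 * \<bar>?t i - activity a b q\<bar>) \<longlonglongrightarrow> (a + b) / 2 * \<bar>activity a b q - activity a b q\<bar>"
      by (intro tendsto_intros t(1))
    then have lim0: "(\<lambda>i. (a + b) / 2 * \<bar>?t i - activity a b q\<bar>) \<longlonglongrightarrow> 0" by simp
    have "(\<lambda>i. free_energy (Gs i) (?t i) - free_energy (Gs i) (activity a b q)) \<longlonglongrightarrow> 0"
    proof (rule Lim_null_comparison[OF _ lim0])
      show "\<forall>\<^sub>F i in sequentially. norm (free_energy (Gs i) (?t i) - free_energy (Gs i) (activity a b q))
          \<le> (a + b) / 2 * \<bar>?t i - activity a b q\<bar>"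
        using order_tendstoD(1)[OF t(1) pos]
        by (rule eventually_mono) (use free_energy_lipschitz pos in simp)
    qed
    from tendsto_add[OF this free_energy_tendsto[OF q]]
    have "(\<lambda>i. free_energy (Gs i) (?t i)) \<longlonglongrightarrow> free_energy_limit q" by simp
    then have "(\<lambda>i. free_energy (Gs i) (?t i) - p / 2 * ln (?t i)) \<longlonglongrightarrow> free_energy_limit q - p / 2 * ln (activity a b q)"
      using pos by (intro tendsto_intros t(1)) auto
    then show ?thesis using False p0 by (simp add: lambda_open_def free_energy_def)
  qed
  then show ?thesis by (rule Lim_transform_eventually[OF _ lam])
qed

text \<open>Both sides are combinations of the same logarithms with equal coefficients. The right
  side has the advantage of remaining continuous at p0, where the terms on the left diverge.\<close>

lemma free_energy_limit_entropy:
  fixes q :: real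
  assumes q: "q \<in> adm" "q > 0"
  shows "free_energy_limit q - a * b / (a + b) * q * ln (activity a b q)
    = a / (a + b) * Hent (b * q) + b / (a + b) * Hent (a * q)
      + a * b / (a + b) * q * ln (a * b) - a * b / (a + b) * Hent q"
proof -
  have pos: "1 - q > 0" "1 - a * q > 0" "1 - b * q > 0" using admD[OF q(1)] by auto
  have H: "Hent z = - (z * ln z) - (1 - z) * ln (1 - z)" if "z < 1" "z > 0" for z
    using that by (simp add: Hent_def)
  have ab: "real a > 0" "real b > 0" using apos bpos by simp_all
  have lnact: "ln (activity a b q) = ln q + ln (1 - q) - ln (1 - a * q) - ln (1 - b * q)"
    unfolding activity_def using pos q(2) by (simp add: ln_div ln_mult)
  have lns: "ln (a * q) = ln a + ln q" "ln (b * q) = ln b + ln q" "ln (real (a * b)) = ln a + ln b"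
    using ab q(2) by (simp_all add: ln_mult)
  have Hs: "Hent (a * q) = - (a * q * (ln a + ln q)) - (1 - a * q) * ln (1 - a * q)"
    "Hent (b * q) = - (b * q * (ln b + ln q)) - (1 - b * q) * ln (1 - b * q)"
    "Hent q = - (q * ln q) - (1 - q) * ln (1 - q)"
    using H[of "a * q"] H[of "b * q"] H[of q] pos ab q(2) lns by simp_all
  \<comment> \<open>Naming the reciprocal makes the identity polynomial in s and the
    logarithms.\<close>
  define s where "s = 1 / (real a + real b)"
  have d: "x / real (a + b) = x * s" for x by (simp add: s_def)
  show ?thesis
    unfolding free_energy_limit_def Hs lns lnact d by (simp add: algebra_simps)
qed

end

section \<open>The limits\<close>

lemma continuous_on_times_ln: "continuous_on {0..} (\<lambda>x::real. x * ln x)"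
  unfolding continuous_on_eq_continuous_within
proof
  fix x :: real assume x: "x \<in> {0..}"
  show "continuous (at x within {0..}) (\<lambda>x. x * ln x)"
  proof (cases "x = 0")
    case False
    then have "isCont (\<lambda>x. x * ln x) x" using x by (intro continuous_intros) auto
    then show ?thesis by (rule continuous_at_imp_continuous_at_within)
  next
    case True
    \<comment> \<open>The substitution of 1/x for x reduces the behaviour at 0 to ln x / x at
      infinity.\<close>
    have "((\<lambda>x::real. - (ln (inverse x) / inverse x)) \<longlongrightarrow> - 0) (at_right 0)"
      by (intro tendsto_minus filterlim_compose[OF ln_x_over_x_tendsto_0 filterlim_inverse_at_top_right])
    moreover have "\<forall>\<^sub>F x::real in at_right 0. - (ln (inverse x) / inverse x) = x * ln x"
      by (rule eventually_at_right_less[THEN eventually_mono]) (simp add: ln_inverse divide_inverse)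
    ultimately have "((\<lambda>x::real. x * ln x) \<longlongrightarrow> 0) (at_right 0)"
      using Lim_transform_eventually by force
    then show ?thesis unfolding True continuous_within by (simp add: at_within_Ici_at_right)
  qed
qed

lemma continuous_on_Hent: "continuous_on {0..1} Hent"
proof -
  \<comment> \<open>The formula takes the value 0 at both end points because 0 * ln 0 = 0 and ln 1 =
    0.\<close>
  have eq: "Hent = (\<lambda>q. - (q * ln q + (1 - q) * ln (1 - q)))" by (auto simp: Hent_def)
  have "continuous_on {0..1} (\<lambda>q::real. q * ln q)"
    by (rule continuous_on_subset[OF continuous_on_times_ln]) auto
  moreover have "continuous_on {0..1} (\<lambda>q::real. (1 - q) * ln (1 - q))"
    by (rule continuous_on_compose2[OF continuous_on_times_ln]) (auto intro!: continuous_intros)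
  ultimately show ?thesis unfolding eq by (intro continuous_on_minus continuous_on_add)
qed

theorem theorem2p16:
  fixes a b :: nat and Gs :: "nat \<Rightarrow> graph"
  assumes apos: "a > 0" and bpos: "b > 0"
    and breg: "\<And>i. biregular_bipartite a b (Gs i)"
    and nonempty: "\<And>i. verts (Gs i) \<noteq> {}"
    and girth_inf: "\<And>n::nat. \<forall>\<^sub>F i in sequentially. enat n \<le> girth (Gs i)"
  defines "p0 \<equiv> min (2 * real a / (real a + real b)) (2 * real b / (real a + real b))"
  shows
    "(\<forall>t::real. t \<ge> 0 \<longrightarrow>
       (\<lambda>i. p_fun (Gs i) t) \<longlonglongrightarrow>
         (2*a*b*t + 2*a*b/(a+b) - 2*a*b/(a+b) * sqrt (1 + (2 * real a + 2 * real b - 4) * t + (real a - real b)^2 * t^2))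
           / (2*a*b*t + 2))
     \<and> (\<forall>p::real. 0 \<le> p \<and> p < p0 \<longrightarrow>
       (\<lambda>i. t_fun (Gs i) p) \<longlonglongrightarrow>
         (a+b)/(2*a*b) * (p * (1 - (a+b)/(2*a*b) * p))
           / ((1 - (a+b)/(2*a) * p) * (1 - (a+b)/(2*b) * p)))
     \<and> (\<forall>p::real. 0 \<le> p \<and> p < p0 \<longrightarrow>
       (\<lambda>i. lambda_G (Gs i) p) \<longlonglongrightarrow>
         a/(a+b) * Hent ((a+b)/(2*a) * p) + b/(a+b) * Hent ((a+b)/(2*b) * p)
         + 1/2 * p * ln (a*b) - a*b/(a+b) * Hent ((a+b)/(2*a*b) * p))
     \<and> ((\<lambda>p. lim (\<lambda>i. lambda_G (Gs i) p)) \<longlongrightarrow>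
         a/(a+b) * Hent ((a+b)/(2*a) * p0) + b/(a+b) * Hent ((a+b)/(2*b) * p0)
         + 1/2 * p0 * ln (a*b) - a*b/(a+b) * Hent ((a+b)/(2*a*b) * p0)) (at_left p0)"
proof -
  interpret large_girth_sequence a b Gs
    by unfold_locales (fact apos bpos breg nonempty girth_inf)+
  have ab: "real a > 0" "real b > 0" using apos bpos by simp_all
  define Lam where "Lam p = a/(a+b) * Hent ((a+b)/(2*a) * p) + b/(a+b) * Hent ((a+b)/(2*b) * p)
    + 1/2 * p * ln (a*b) - a*b/(a+b) * Hent ((a+b)/(2*a*b) * p)" for p :: real
  \<comment> \<open>The edge probability q belonging to the density p.\<close>
  define occ where "occ p = (a+b)/(2*a*b) * p" for p :: real
  have occ: "a * occ p = (a+b)/(2*b) * p" "b * occ p = (a+b)/(2*a) * p"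
    for p
    using ab by (simp_all add: occ_def field_simps)
  have occ_inv: "2 * real a * real b / (real a + real b) * occ p = p" for p
    using ab add_pos_pos[OF ab] by (simp add: occ_def)
  have p0: "(a+b)/(2*b) * p < 1 \<and> (a+b)/(2*a) * p < 1 \<longleftrightarrow> p < p0"
    "(a+b)/(2*b) * p \<le> 1 \<and> (a+b)/(2*a) * p \<le> 1 \<longleftrightarrow> p \<le> p0" for p
    using ab unfolding p0_def by (auto simp: field_simps)
  have adm: "occ p \<in> adm" if "0 \<le> p" "p < p0" for p
    using p0(1)[of p] that unfolding adm_def occ mem_Collect_eq by (simp add: occ_def)
  have activity: "activity a b (occ p) = (a+b)/(2*a*b) * (p * (1 - (a+b)/(2*a*b) * p))
      / ((1 - (a+b)/(2*a) * p) * (1 - (a+b)/(2*b) * p))" for p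
    unfolding activity_def occ unfolding occ_def by (simp only: mult_ac)
  have parta: "(\<lambda>i. p_fun (Gs i) t) \<longlonglongrightarrow>
         (2*a*b*t + 2*a*b/(a+b) - 2*a*b/(a+b) * sqrt (1 + (2 * real a + 2 * real b - 4) * t + (real a - real b)^2 * t^2))
           / (2*a*b*t + 2)" if t: "t \<ge> 0" for t :: real
  proof -
    define R where "R = sqrt (1 + (2 * real a + 2 * real b - 4) * t + (real a - real b)^2 * t^2)"
    define q where "q = ((real a + b) * t + 1 - R) / (2 * (real a * b * t + 1))"
    define K where "K = 2 * real a * real b / (real a + real b)"
    \<comment> \<open>Multiplying the numerator of q by \<open>K\<close> turns (a+b)t into 2abt, the
      shape required in (a).\<close>
    have "K * (real a + real b) = 2 * real a * real b" unfolding K_def using ab by simp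
    moreover have "K * ((real a + b) * t + 1 - R) = K * (real a + real b) * t + K - K * R"
      by (simp add: algebra_simps)
    moreover have "2 * (real a * b * t + 1) = 2 * real a * real b * t + 2" by simp
    ultimately have Kq: "K * q = (2 * real a * real b * t + K - K * R) / (2 * real a * real b * t + 2)"
      unfolding q_def by (metis times_divide_eq_right)
    have "(\<lambda>i. p_fun (Gs i) t) \<longlonglongrightarrow> K * q"
      using p_fun_tendsto[OF ex_activity(1)[OF t]] unfolding ex_activity(2)[OF t] q_def K_def R_def .
    then show ?thesis
      unfolding Kq of_nat_mult of_nat_add of_nat_numeral R_def[symmetric] K_def[symmetric] .
  qed
  have partb: "(\<lambda>i. t_fun (Gs i) p) \<longlonglongrightarrow> activity a b (occ p)" if "0 \<le> p" "p < p0" for p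
    using t_fun_tendsto(1)[OF adm[OF that]] unfolding occ_inv .
  have partc: "(\<lambda>i. lambda_G (Gs i) p) \<longlonglongrightarrow> Lam p" if p: "0 \<le> p" "p < p0" for p
  proof -
    have "Lam p = (if occ p = 0 then 0 else free_energy_limit (occ p) - p / 2 * ln (activity a b (occ p)))"
    proof (cases "p = 0")
      case True
      then show ?thesis by (simp add: Lam_def occ_def Hent_def)
    next
      case False
      then have pos: "occ p > 0" using p ab by (simp add: occ_def)
      have half: "a * b / (a + b) * occ p = p / 2" using occ_inv[of p] by (simp add: mult_ac)
      have "free_energy_limit (occ p) - p / 2 * ln (activity a b (occ p)) = Lam p"
        using free_energy_limit_entropy[OF adm[OF p] pos] unfolding occ half Lam_def occ_def[symmetric] by simp
      then show ?thesis using pos by simp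
    qed
    then show ?thesis using lambda_G_tendsto[OF adm[OF p]] unfolding occ_inv by simp
  qed
  have p0_pos: "0 < p0" unfolding p0_def using ab by simp
  have "continuous_on {0..p0} Lam"
  proof -
    have rng: "(a+b)/(2*b) * p \<in> {0..1} \<and> (a+b)/(2*a) * p \<in> {0..1} \<and> (a+b)/(2*a*b) * p \<in> {0..1}"
      if "p \<in> {0..p0}" for p
    proof -
      have 1: "(a+b)/(2*b) * p \<le> 1" "(a+b)/(2*a) * p \<le> 1" using p0(2)[of p] that by auto
      \<comment> \<open>The third entropy has argument q, which is at most aq and hence at most
        1.\<close>
      have "1 * occ p \<le> a * occ p" using ab that apos by (intro mult_right_mono) (auto simp: occ_def)
      then have "(a+b)/(2*a*b) * p \<le> 1" using 1 unfolding occ by (simp add: occ_def)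
      then show ?thesis using 1 that by simp
    qed
    show ?thesis unfolding Lam_def[abs_def]
      by (intro continuous_intros continuous_on_compose2[OF continuous_on_Hent]) (use rng in blast)+
  qed
  then have "(Lam \<longlongrightarrow> Lam p0) (at p0 within {0..p0})"
    using p0_pos by (simp add: continuous_on_def)
  then have "(Lam \<longlongrightarrow> Lam p0) (at_left p0)"
    unfolding at_within_Icc_at_left[OF p0_pos] .
  \<comment> \<open>Only values of p in (0, p0) matter for the left limit, and there the limit over
    i is already identified.\<close>
  moreover have "\<forall>\<^sub>F p in at_left p0. Lam p = lim (\<lambda>i. lambda_G (Gs i) p)"
    using eventually_at_left_real[OF p0_pos]
    by (rule eventually_mono) (simp add: limI[OF partc])
  ultimately have partd: "((\<lambda>p. lim (\<lambda>i. lambda_G (Gs i) p)) \<longlongrightarrow> Lam p0) (at_left p0)"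
    by (rule Lim_transform_eventually)
  show ?thesis
    using parta partb[unfolded activity] partc partd unfolding Lam_def by blast
qed

end
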